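(* If $G$ is a $3$-connected cubic graph all of whose flow roots are real, then $G$ is the dual of a chordal planar triangulation.
   Context: The flow polynomial $F(G;\lambda)$ is the polynomial whose value at a positive integer $\lambda$ is the number of nowhere-zero flows on $G$ taking values in an abelian group of order $\lambda$; its roots are the flow roots of $G$. A graph is chordal if it has no induced cycle of length greater than $3$. A planar triangulation is a plane graph all of whose faces are triangles. "$G$ is the dual of $H$" means $G$ is the geometric dual of a plane embedding of $H$. *)

theory Defs
  imports
    "HOL-Analysis.Analysis"
    "HOL-Computational_Algebra.Polynomial"
    "HOL-Algebra.FiniteProduct"
    "Graph_Theory.Digraph"
    "Graph_Theory.Digraph_Component"
begin

text \<open>
  A finite graph, with loops and parallel edges allowed, is given by a \<^const>\<open>fin_digraph\<close>:
  its arcs are the edges of the graph and the directions are an arbitrary reference orientation,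
  which flows need anyway. Only the definition of a flow looks at the directions.
\<close>

section \<open>Connectivity and regularity\<close>

text \<open>The constant \<^const>\<open>Digraph_Component.connected\<close> ignores directions
  and requires at least one vertex.\<close>

definition k_connected :: "nat \<Rightarrow> ('v, 'e) pre_digraph \<Rightarrow> bool" where
  "k_connected k G \<longleftrightarrow> card (verts G) > k \<and>
     (\<forall>X \<subseteq> verts G. card X < k \<longrightarrow>
        Digraph_Component.connected (induce_subgraph G (verts G - X)))"

text \<open>A loop counts twice towards the degree of its vertex.\<close>

definition cubic :: "('v, 'e) pre_digraph \<Rightarrow> bool" where
  "cubic G \<longleftrightarrow> (\<forall>v \<in> verts G. in_degree G v + out_degree G v = 3)"

section \<open>The flow polynomial\<close>

text \<open>The group is written multiplicatively, so \<open>\<one>\<close> is its zero and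
  \<^const>\<open>finprod\<close> is the sum of flow values.\<close>

definition nz_flows :: "('a, 'm) monoid_scheme \<Rightarrow> ('v, 'e) pre_digraph \<Rightarrow> ('e \<Rightarrow> 'a) set" where
  "nz_flows A G =
     {f \<in> arcs G \<rightarrow>\<^sub>E (carrier A - {\<one>\<^bsub>A\<^esub>}).
        \<forall>v \<in> verts G. finprod A f (in_arcs G v) = finprod A f (out_arcs G v)}"

text \<open>Carriers inside \<^typ>\<open>nat\<close> suffice: every finite group is isomorphic to one of these.\<close>

definition flow_poly :: "('v, 'e) pre_digraph \<Rightarrow> complex poly" where
  "flow_poly G = (THE p. \<forall>A :: nat monoid. comm_group A \<and> finite (carrier A) \<longrightarrow>
     poly p (of_nat (card (carrier A))) = of_nat (card (nz_flows A G)))"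

definition flow_roots :: "('v, 'e) pre_digraph \<Rightarrow> complex set" where
  "flow_roots G = {z. poly (flow_poly G) z = 0}"

section \<open>Plane graphs\<close>

text \<open>
  A (simple) plane graph consists of a finite set \<open>V\<close> of points and a set \<open>E\<close> of
  arcs, as point sets. The ends of an edge \<open>e\<close> are recovered as \<open>e \<inter> V\<close>,
  because no interior point of an edge is a vertex.
\<close>

definition plane_graph :: "complex set \<Rightarrow> complex set set \<Rightarrow> bool" where
  "plane_graph V E \<longleftrightarrow> finite V \<and>
     (\<forall>e \<in> E. \<exists>g. arc g \<and> path_image g = e \<and> e \<inter> V = {pathstart g, pathfinish g}) \<and>
     (\<forall>e \<in> E. \<forall>e' \<in> E. e \<noteq> e' \<longrightarrow> e \<inter> V \<noteq> e' \<inter> V \<and> e \<inter> e' \<subseteq> V)"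

definition plane_adj :: "complex set \<Rightarrow> complex set set \<Rightarrow> complex \<Rightarrow> complex \<Rightarrow> bool" where
  "plane_adj V E x y \<longleftrightarrow> x \<noteq> y \<and> (\<exists>e \<in> E. e \<inter> V = {x, y})"

definition plane_faces :: "complex set \<Rightarrow> complex set set \<Rightarrow> complex set set" where
  "plane_faces V E = components (- (V \<union> \<Union>E))"

text \<open>Every face, the unbounded one included, is bounded by a 3-cycle.\<close>

definition plane_triangulation :: "complex set \<Rightarrow> complex set set \<Rightarrow> bool" where
  "plane_triangulation V E \<longleftrightarrow> plane_graph V E \<and>
     (\<forall>F \<in> plane_faces V E. \<exists>a b c e1 e2 e3.
        distinct [a, b, c] \<and> {e1, e2, e3} \<subseteq> E \<and>
        e1 \<inter> V = {a, b} \<and> e2 \<inter> V = {b, c} \<and> e3 \<inter> V = {c, a} \<and>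
        frontier F = e1 \<union> e2 \<union> e3)"

section \<open>Chordal graphs\<close>

definition induced_cycle :: "'a set \<Rightarrow> ('a \<Rightarrow> 'a \<Rightarrow> bool) \<Rightarrow> 'a list \<Rightarrow> bool" where
  "induced_cycle V adj vs \<longleftrightarrow> length vs \<ge> 3 \<and> distinct vs \<and> set vs \<subseteq> V \<and>
     (\<forall>i j. i < j \<and> j < length vs \<longrightarrow>
        (adj (vs ! i) (vs ! j) \<longleftrightarrow> j = i + 1 \<or> i = 0 \<and> j = length vs - 1))"

definition chordal :: "'a set \<Rightarrow> ('a \<Rightarrow> 'a \<Rightarrow> bool) \<Rightarrow> bool" where
  "chordal V adj \<longleftrightarrow> \<not> (\<exists>vs. induced_cycle V adj vs \<and> length vs > 3)"

section \<open>Geometric duality\<close>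

text \<open>
  The vertices of the dual are the faces, its edges correspond to the edges of the plane graph,
  and the edge dual to \<open>e\<close> joins the two faces with \<open>e\<close> on their boundary
  (it is a loop if there is only one such face).
\<close>

definition geometric_dual :: "('v, 'e) pre_digraph \<Rightarrow> complex set \<Rightarrow> complex set set \<Rightarrow> bool" where
  "geometric_dual G V E \<longleftrightarrow>
     (\<exists>\<phi> \<psi>. bij_betw \<phi> (verts G) (plane_faces V E) \<and> bij_betw \<psi> (arcs G) E \<and>
        (\<forall>e \<in> arcs G. {\<phi> (tail G e), \<phi> (head G e)} =
           {F \<in> plane_faces V E. \<psi> e \<subseteq> frontier F}))"

end

theory Submission
  imports Defs "HOL-Computational_Algebra.Fundamental_Theorem_Algebra"
begin

text \<open>
  Let \<open>G\<close> have \<open>2m\<close> vertices and \<open>t\<close> 3-edge-cuts. Counting flows by their support shows that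
  the flow polynomial has degree \<open>m + 1\<close> and that its three leading coefficients are \<open>1\<close>,
  \<open>-3m\<close> and \<open>(3m choose 2) - t\<close>. Its roots \<open>z\<close> therefore satisfy
  \<open>\<Sum>(z - 3)\<^sup>2 = 2t - 6m + 9\<close>; since 1 and 2 are roots and all roots are real, \<open>t \<ge> 3m - 2\<close>.

  On the other hand, fix a vertex \<open>r\<close>. The 3-edge-cuts correspond to the sets of vertices
  avoiding \<open>r\<close> with three boundary edges. These sets have odd size and form a laminar family, so
  there are at most \<open>3m - 2\<close> of them, with equality only if each of them that is not a singleton
  splits into exactly three others. Each pair of parts then spans one edge and each part keeps
  one of the three boundary edges. Dually, such a split places a new vertex inside a triangular
  face and joins it to the three corners. Starting from a triangle whose outer face represents
  \<open>r\<close>, the splits produce a straight-line triangulation that is dual to \<open>G\<close>, and it is chordal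
  because each new vertex is joined to a clique.
\<close>

text \<open>The squares are centred at 3 because the graphs sought have flow polynomial
  \<open>(x - 1) * (x - 2) * (x - 3) ^ (m - 1)\<close>: each stacked vertex contributes a factor
  \<open>x - 3\<close> to the chromatic polynomial of the dual. For these graphs the estimate from
  the roots is an equality, which is why it can meet the laminarity bound exactly.

  Planarity is not assumed, so there is no embedding to dualize; one has to be built. A partition of
  the vertices other than \<open>r\<close> into extremal sets stands for the cubic graph in which
  each set is contracted. The invariant of the construction is a straight-line drawing of the dual
  of that contracted graph, and splitting a set undoes a contraction. Straight segments and explicit
  triangles make the faces known in advance, so that they only have to be recognized as the
  components of the complement.\<close>

section \<open>Laminar families of odd sets\<close>

text \<open>The maximal members strictly inside \<open>A\<close> partition \<open>A\<close>: the
  singletons force them to cover it, and laminarity makes them disjoint. Their number is odd, since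
  odd sizes add up to an odd size, and it is not one; so there are at least three. Of the summands 1
  in the bounds for the parts, two pay for counting \<open>A\<close> itself and one is left for the
  bound of \<open>A\<close>. Equality therefore means exactly three parts, each extremal. Doubling
  keeps the bound in the natural numbers.\<close>

lemma laminar_odd_card:
  assumes "finite A" "A \<in> N"
    and lam: "\<And>B C. B \<in> N \<Longrightarrow> C \<in> N \<Longrightarrow> B \<inter> C = {} \<or> B \<subseteq> C \<or> C \<subseteq> B"
    and odd: "\<And>B. B \<in> N \<Longrightarrow> odd (card B)"
    and sing: "\<And>x. x \<in> A \<Longrightarrow> {x} \<in> N"
  shows "2 * card {B \<in> N. B \<subseteq> A} + 1 \<le> 3 * card A \<and>
     (2 * card {B \<in> N. B \<subseteq> A} + 1 = 3 * card A \<longrightarrow> card A \<noteq> 1 \<longrightarrow>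
       (\<exists>S \<subseteq> N. card S = 3 \<and> disjoint S \<and> \<Union>S = A \<and>
          (\<forall>B \<in> S. 2 * card {C \<in> N. C \<subseteq> B} + 1 = 3 * card B)))"
  using assms(1,2) sing
proof (induction "card A" arbitrary: A rule: less_induct)
  case less
  define n where "n = (\<lambda>B. card {C \<in> N. C \<subseteq> B})"
  have ne: "B \<noteq> {}" if "B \<in> N" for B using odd[OF that] by auto
  show ?case
  proof (cases "card A = 1")
    case True
    then obtain x where "A = {x}" by (auto simp: card_1_singleton_iff)
    then have "{B \<in> N. B \<subseteq> A} = {A}" using less.prems ne by auto
    then show ?thesis using True by simp
  next
    case False
    define Q where "Q = {B \<in> N. B \<subset> A}"
    define S where "S = {B \<in> Q. \<forall>C \<in> Q. B \<subseteq> C \<longrightarrow> B = C}"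
    have finQ: "finite Q"
      by (rule finite_subset[of _ "Pow A"]) (use less.prems(1) in \<open>auto simp: Q_def\<close>)
    then have finS: "finite S" unfolding S_def by auto
    have SQ: "S \<subseteq> Q" and SN: "S \<subseteq> N" unfolding S_def Q_def by auto
    have max: "\<exists>C \<in> S. B \<subseteq> C" if B: "B \<in> Q" for B
    proof -
      obtain C where "C \<in> Q" "B \<subseteq> C" "\<forall>D \<in> Q. C \<subseteq> D \<longrightarrow> C = D"
        using finite_has_maximal2[OF finQ B] by blast
      then show ?thesis unfolding S_def by auto
    qed
    have cover: "\<Union>S = A"
    proof
      show "\<Union>S \<subseteq> A" using SQ unfolding Q_def by auto
      show "A \<subseteq> \<Union>S"
      proof
        fix x assume "x \<in> A"
        then have "{x} \<in> Q" unfolding Q_def using less.prems(3) False by auto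
        from max[OF this] show "x \<in> \<Union>S" by auto
      qed
    qed
    have disj: "disjoint S"
    proof (rule disjointI)
      fix B C assume "B \<in> S" "C \<in> S" "B \<noteq> C"
      then show "B \<inter> C = {}" using lam[of B C] SN unfolding S_def by blast
    qed
    have finB: "finite B" if "B \<in> S" for B
      using that SQ less.prems(1) finite_subset unfolding Q_def by blast
    have cardA: "card A = sum card S"
      using card_Union_disjoint[OF disj finB] cover by simp
    have finsub: "finite {C \<in> N. C \<subseteq> B}" if "B \<in> S" for B
      by (rule finite_subset[of _ "Pow B"]) (use finB[OF that] in auto)
    have less_card: "card B < card A" if "B \<in> S" for B
      using that SQ less.prems(1) psubset_card_mono unfolding Q_def by blast
    have IH: "2 * n B + 1 \<le> 3 * card B" if "B \<in> S" for B
    proof -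
      have "B \<subset> A" "B \<in> N" using that SQ Q_def by auto
      then show ?thesis
        using less.hyps[OF less_card[OF that] finB[OF that]] less.prems(3) unfolding n_def by blast
    qed
    have decomp: "{B \<in> N. B \<subseteq> A} = insert A (\<Union>B\<in>S. {C \<in> N. C \<subseteq> B})"
    proof
      show "{B \<in> N. B \<subseteq> A} \<subseteq> insert A (\<Union>B\<in>S. {C \<in> N. C \<subseteq> B})"
        using max unfolding Q_def by fastforce
      show "insert A (\<Union>B\<in>S. {C \<in> N. C \<subseteq> B}) \<subseteq> {B \<in> N. B \<subseteq> A}"
        using less.prems cover by auto
    qed
    have "card (\<Union>B\<in>S. {C \<in> N. C \<subseteq> B}) = (\<Sum>B\<in>S. n B)"
      unfolding n_def
    proof (rule card_UN_disjoint[OF finS])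
      show "\<forall>i\<in>S. finite {C \<in> N. C \<subseteq> i}" using finsub by auto
      show "\<forall>i\<in>S. \<forall>j\<in>S. i \<noteq> j \<longrightarrow> {C \<in> N. C \<subseteq> i} \<inter> {C \<in> N. C \<subseteq> j} = {}"
        using disj ne unfolding disjoint_def by fastforce
    qed
    moreover have "A \<notin> (\<Union>B\<in>S. {C \<in> N. C \<subseteq> B})" using SQ unfolding Q_def by auto
    moreover have "finite (\<Union>B\<in>S. {C \<in> N. C \<subseteq> B})" using finsub finS by auto
    ultimately have nA: "n A = 1 + (\<Sum>B\<in>S. n B)" unfolding n_def decomp by simp
    have "even (sum card S) = even (card {B\<in>S. odd (card B)})"
      by (rule even_sum_iff[OF finS])
    moreover have "{B\<in>S. odd (card B)} = S" using odd SN by auto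
    ultimately have oddS: "odd (card S)" using odd[OF less.prems(2)] cardA by simp
    have "card S \<noteq> 1"
    proof
      assume "card S = 1"
      then obtain B where "S = {B}" by (auto simp: card_1_singleton_iff)
      then show False using cover SQ unfolding Q_def by auto
    qed
    then have S3: "3 \<le> card S" using oddS by presburger
    have sum_le: "(\<Sum>B\<in>S. 2 * n B + 1) \<le> (\<Sum>B\<in>S. 3 * card B)" by (rule sum_mono) (rule IH)
    have sum_eq: "(\<Sum>B\<in>S. 2 * n B + 1) = 2 * (\<Sum>B\<in>S. n B) + card S"
      "(\<Sum>B\<in>S. 3 * card B) = 3 * card A"
      by (simp_all only: sum.distrib flip: sum_distrib_left) (simp_all add: cardA)
    have bound: "2 * n A + 1 \<le> 3 * card A" using sum_le sum_eq nA S3 by linarith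
    moreover have "\<exists>S\<subseteq>N. card S = 3 \<and> disjoint S \<and> \<Union>S = A \<and> (\<forall>B\<in>S. 2 * n B + 1 = 3 * card B)"
      if eq: "2 * n A + 1 = 3 * card A"
    proof (intro exI conjI)
      show "card S = 3" using sum_le sum_eq nA S3 eq by linarith
      then have "(\<Sum>B\<in>S. 2 * n B + 1) = (\<Sum>B\<in>S. 3 * card B)"
        using sum_le sum_eq nA eq by linarith
      then show "\<forall>B\<in>S. 2 * n B + 1 = 3 * card B"
        using sum_mono_inv[of "\<lambda>B. 2 * n B + 1" S "\<lambda>B. 3 * card B"] IH finS by blast
    qed (use SN disj cover in auto)
    ultimately show ?thesis unfolding n_def by blast
  qed
qed

section \<open>Edge cuts\<close>

text \<open>The coboundary over the two-element field, which is why symmetric differences of vertex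
  sets become symmetric differences of cuts. Loops never belong to a cut.\<close>

definition edge_cut :: "('v, 'e) pre_digraph \<Rightarrow> 'v set \<Rightarrow> 'e set" where
  "edge_cut G X = {e \<in> arcs G. (tail G e \<in> X) \<noteq> (head G e \<in> X)}"

lemma edge_cut_empty [simp]: "edge_cut G {} = {}"
  by (simp add: edge_cut_def)

lemma edge_cut_subset: "edge_cut G X \<subseteq> arcs G"
  by (auto simp: edge_cut_def)

lemma (in fin_digraph) finite_edge_cut [simp]: "finite (edge_cut G X)"
  by (rule finite_subset[OF edge_cut_subset]) simp

lemma (in wf_digraph) edge_cut_Compl: "edge_cut G (verts G - X) = edge_cut G X"
  by (auto simp: edge_cut_def)

lemma edge_cut_sym_diff: "edge_cut G (sym_diff X Y) = sym_diff (edge_cut G X) (edge_cut G Y)"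
  by (auto simp: edge_cut_def)

lemma edge_cut_disjoint_Un: "X \<inter> Y = {} \<Longrightarrow> edge_cut G (X \<union> Y) = sym_diff (edge_cut G X) (edge_cut G Y)"
  by (auto simp: edge_cut_def)

text \<open>Submodularity and posimodularity of the cut function. Once cuts are sums of indicators
  over the edges, both hold edge by edge.\<close>

lemma (in fin_digraph) card_edge_cut_uncross:
  "card (edge_cut G (X \<inter> Y)) + card (edge_cut G (X \<union> Y)) \<le> card (edge_cut G X) + card (edge_cut G Y)"
  "card (edge_cut G (X - Y)) + card (edge_cut G (Y - X)) \<le> card (edge_cut G X) + card (edge_cut G Y)"
proof -
  have c: "card (edge_cut G Z) = (\<Sum>e\<in>arcs G. if (tail G e \<in> Z) \<noteq> (head G e \<in> Z) then 1 else 0)" for Z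
    by (simp add: edge_cut_def sum.If_cases Int_def)
  show "card (edge_cut G (X \<inter> Y)) + card (edge_cut G (X \<union> Y)) \<le> card (edge_cut G X) + card (edge_cut G Y)"
    "card (edge_cut G (X - Y)) + card (edge_cut G (Y - X)) \<le> card (edge_cut G X) + card (edge_cut G Y)"
    unfolding c by (simp_all only: flip: sum.distrib) (auto intro!: sum_mono)
qed

text \<open>The degree sum over \<open>X\<close> counts an edge inside \<open>X\<close> twice, loops
  included, and a cut edge once.\<close>

lemma (in fin_digraph) cubic_edge_cut_parity:
  assumes "cubic G" "X \<subseteq> verts G"
  shows "3 * card X = 2 * card {e \<in> arcs G. tail G e \<in> X \<and> head G e \<in> X} + card (edge_cut G X)"
proof -
  have finX: "finite X" using assms(2) finite_subset finite_verts by blast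
  have t: "(\<Sum>v\<in>X. out_degree G v) = card {e \<in> arcs G. tail G e \<in> X}"
  proof -
    have "card (\<Union>v\<in>X. out_arcs G v) = (\<Sum>v\<in>X. card (out_arcs G v))"
      using finX by (intro card_UN_disjoint) auto
    moreover have "(\<Union>v\<in>X. out_arcs G v) = {e \<in> arcs G. tail G e \<in> X}" by auto
    ultimately show ?thesis by (simp add: out_degree_def)
  qed
  have h: "(\<Sum>v\<in>X. in_degree G v) = card {e \<in> arcs G. head G e \<in> X}"
  proof -
    have "card (\<Union>v\<in>X. in_arcs G v) = (\<Sum>v\<in>X. card (in_arcs G v))"
      using finX by (intro card_UN_disjoint) auto
    moreover have "(\<Union>v\<in>X. in_arcs G v) = {e \<in> arcs G. head G e \<in> X}" by auto
    ultimately show ?thesis by (simp add: in_degree_def)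
  qed
  have "3 * card X = (\<Sum>v\<in>X. in_degree G v + out_degree G v)"
    using assms unfolding cubic_def by (simp add: subset_eq)
  also have "\<dots> = card {e \<in> arcs G. head G e \<in> X} + card {e \<in> arcs G. tail G e \<in> X}"
    by (simp add: sum.distrib t h)
  also have "\<dots> = card ({e \<in> arcs G. head G e \<in> X} \<union> {e \<in> arcs G. tail G e \<in> X}) +
      card ({e \<in> arcs G. head G e \<in> X} \<inter> {e \<in> arcs G. tail G e \<in> X})"
    by (rule card_Un_Int) auto
  also have "{e \<in> arcs G. head G e \<in> X} \<inter> {e \<in> arcs G. tail G e \<in> X} =
      {e \<in> arcs G. tail G e \<in> X \<and> head G e \<in> X}" by auto
  also have "{e \<in> arcs G. head G e \<in> X} \<union> {e \<in> arcs G. tail G e \<in> X} =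
      {e \<in> arcs G. tail G e \<in> X \<and> head G e \<in> X} \<union> edge_cut G X" by (auto simp: edge_cut_def)
  also have "card \<dots> = card {e \<in> arcs G. tail G e \<in> X \<and> head G e \<in> X} + card (edge_cut G X)"
    by (rule card_Un_disjoint) (auto simp: edge_cut_def)
  finally show ?thesis by simp
qed

lemma connected_edge_cut_nonempty:
  assumes "Digraph_Component.connected H" "X \<subseteq> verts H" "X \<noteq> {}" "X \<noteq> verts H"
  shows "edge_cut H X \<noteq> {}"
proof
  assume e: "edge_cut H X = {}"
  obtain x y where "x \<in> X" "y \<in> verts H" "y \<notin> X" using assms by auto
  then have "(x, y) \<in> rtrancl_on (verts H) (parcs (mk_symmetric H))"
    using assms unfolding connected_def strongly_connected_def reachable_def
    by (auto simp: mk_symmetric_def)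
  then have "x \<in> X \<longrightarrow> y \<in> X"
    by (induction rule: rtrancl_on.induct) (use e in \<open>auto simp: edge_cut_def mk_symmetric_def\<close>)
  then show False using \<open>x \<in> X\<close> \<open>y \<notin> X\<close> by auto
qed

text \<open>Deleting one end of each cut edge separates the graph, provided that a vertex remains on
  either side. With at most two cut edges and more than three vertices the ends can always be chosen
  in this way.\<close>

lemma (in fin_digraph) k_connected_3_edge_cut:
  assumes k: "k_connected 3 G" and X: "X \<subseteq> verts G" "X \<noteq> {}" "X \<noteq> verts G"
  shows "3 \<le> card (edge_cut G X)"
proof (rule ccontr)
  assume "\<not> 3 \<le> card (edge_cut G X)"
  then have le2: "card (edge_cut G X) \<le> 2" by simp
  have V: "card (verts G) > 3" using k unfolding k_connected_def by auto
  have finX: "finite X" "finite (verts G - X)" using X(1) finite_subset finite_verts by blast+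
  have cV: "card X + card (verts G - X) = card (verts G)"
    using X(1) by (metis card_Diff_subset card_mono finX(1) finite_verts le_add_diff_inverse)
  have separator: False
    if Z: "Z \<subseteq> verts G" "card Z \<le> 2" "X - Z \<noteq> {}" "verts G - X - Z \<noteq> {}"
      and hit: "\<And>e. e \<in> edge_cut G X \<Longrightarrow> tail G e \<in> Z \<or> head G e \<in> Z" for Z
  proof -
    let ?H = "induce_subgraph G (verts G - Z)"
    have "Digraph_Component.connected ?H" using k Z unfolding k_connected_def by auto
    then have "edge_cut ?H (X - Z) \<noteq> {}"
      by (rule connected_edge_cut_nonempty) (use X Z in auto)
    then show False using hit by (auto simp: edge_cut_def)
  qed
  define inX where "inX = (\<lambda>e. if tail G e \<in> X then tail G e else head G e)"
  define notX where "notX = (\<lambda>e. if tail G e \<in> X then head G e else tail G e)"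
  have ends: "inX e \<in> X" "notX e \<in> verts G - X" "inX e \<in> {tail G e, head G e}"
    "notX e \<in> {tail G e, head G e}" if "e \<in> edge_cut G X" for e
    using that X unfolding inX_def notX_def edge_cut_def by auto
  have card_im: "card (f ` edge_cut G X) \<le> 2" for f :: "'b \<Rightarrow> 'a"
    using card_image_le[of "edge_cut G X" f] le2 by simp
  \<comment> \<open>On a side with three vertices, deleting at most two ends leaves a vertex, and
    the other side is untouched. If neither side is that large, four vertices must split two and
    two.\<close>
  consider "card X \<ge> 3" | "card (verts G - X) \<ge> 3" | "card X = 2" "card (verts G - X) = 2"
    using cV V by linarith
  then show False
  proof cases
    case 1
    define Z where "Z = inX ` edge_cut G X"
    have "Z \<subseteq> X" "card Z \<le> 2" using ends(1) card_im unfolding Z_def by auto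
    moreover have "X - Z \<noteq> {}"
      using 1 \<open>card Z \<le> 2\<close> card_mono[of Z X] unfolding Z_def by auto
    moreover have "tail G e \<in> Z \<or> head G e \<in> Z" if "e \<in> edge_cut G X" for e
      using ends(3)[OF that] that unfolding Z_def by (metis imageI insertE singletonD)
    ultimately show False using X by (intro separator[of Z]) blast+
  next
    case 2
    define Z where "Z = notX ` edge_cut G X"
    have "Z \<subseteq> verts G - X" "card Z \<le> 2" using ends(2) card_im unfolding Z_def by auto
    moreover have "verts G - X - Z \<noteq> {}"
      using 2 \<open>card Z \<le> 2\<close> card_mono[of Z "verts G - X"] unfolding Z_def by auto
    moreover have "tail G e \<in> Z \<or> head G e \<in> Z" if "e \<in> edge_cut G X" for e
      using ends(4)[OF that] that unfolding Z_def by (metis imageI insertE singletonD)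
    ultimately show False using X by (intro separator[of Z]) blast+
  next
    case 3
    have "edge_cut G X \<noteq> {}"
    proof
      assume "edge_cut G X = {}"
      then show False using X by (intro separator[of "{}"]) auto
    qed
    then obtain e where e: "e \<in> edge_cut G X" by auto
    \<comment> \<open>\<open>e' = e\<close> is allowed and covers a cut with a single edge. The two
      ends are taken on opposite sides, so each side of two vertices keeps one.\<close>
    obtain e' where e': "e' \<in> edge_cut G X" "edge_cut G X \<subseteq> {e, e'}"
    proof (cases "edge_cut G X - {e} = {}")
      case True
      then show thesis using that[of e] e by blast
    next
      case False
      then have "card (edge_cut G X - {e}) = 1"
        using le2 e card_Suc_Diff1[OF finite_edge_cut e] card_gt_0_iff[of "edge_cut G X - {e}"]
        by simp
      then obtain e' where "edge_cut G X - {e} = {e'}" by (auto simp: card_1_singleton_iff)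
      then show thesis using that[of e'] by blast
    qed
    have "X - {inX e, notX e'} \<noteq> {}"
    proof
      assume "X - {inX e, notX e'} = {}"
      then have "X \<subseteq> {inX e}" using ends(2)[OF e'(1)] by blast
      then show False using 3(1) card_mono[of "{inX e}" X] by auto
    qed
    moreover have "verts G - X - {inX e, notX e'} \<noteq> {}"
    proof
      assume "verts G - X - {inX e, notX e'} = {}"
      then have "verts G - X \<subseteq> {notX e'}" using ends(1)[OF e] by blast
      then show False using 3(2) card_mono[of "{notX e'}" "verts G - X"] by auto
    qed
    moreover have "{inX e, notX e'} \<subseteq> verts G" using ends(1)[OF e] ends(2)[OF e'(1)] X(1) by blast
    moreover have "tail G x \<in> {inX e, notX e'} \<or> head G x \<in> {inX e, notX e'}"
      if "x \<in> edge_cut G X" for x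
      using that e'(2) ends(3)[OF e] ends(4)[OF e'(1)] by auto
    moreover have "card {inX e, notX e'} \<le> 2" by (simp add: card_insert_if)
    ultimately show False by (intro separator[of "{inX e, notX e'}"]) blast+
  qed
qed

text \<open>From here on 3-connectivity is present only as 3-edge-connectivity. The vertex
  \<open>r\<close> marks one side of every cut and later becomes the outer face.\<close>

locale edge_connected_cubic = fin_digraph G for G :: "('v, 'e) pre_digraph" +
  fixes r :: 'v
  assumes cubic: "cubic G"
    and cut3: "\<And>X. X \<subseteq> verts G \<Longrightarrow> X \<noteq> {} \<Longrightarrow> X \<noteq> verts G \<Longrightarrow> 3 \<le> card (edge_cut G X)"
    and root: "r \<in> verts G"
begin

lemma odd_card_iff: "X \<subseteq> verts G \<Longrightarrow> odd (card X) \<longleftrightarrow> odd (card (edge_cut G X))"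
  using cubic_edge_cut_parity[OF cubic, of X] by presburger

lemma even_card_edge_cut:
  assumes "X \<subseteq> verts G" "X \<noteq> {}" "X \<noteq> verts G" "even (card X)"
  shows "4 \<le> card (edge_cut G X)"
  using cut3[OF assms(1-3)] odd_card_iff[OF assms(1)] assms(4) by presburger

section \<open>Vertex sets with three boundary edges\<close>

definition tri_sets :: "'v set set" where
  "tri_sets = {X. X \<subseteq> verts G - {r} \<and> card (edge_cut G X) = 3}"

lemma tri_setsD:
  assumes "X \<in> tri_sets"
  shows "X \<subseteq> verts G" "r \<notin> X" "finite X" "odd (card X)" "X \<noteq> {}" "X \<noteq> verts G"
    "card (edge_cut G X) = 3"
proof -
  show X: "X \<subseteq> verts G" "r \<notin> X" "card (edge_cut G X) = 3" using assms unfolding tri_sets_def by auto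
  then show "finite X" "odd (card X)" 
    using finite_subset[OF _ finite_verts] odd_card_iff by auto
  show "X \<noteq> {}" using X(3) by auto
  show "X \<noteq> verts G" using X(2) root by auto
qed

text \<open>Parity rules out crossing 3-edge-cuts: two of the four corners have even size, hence
  a cut of even size, which is at least 4.\<close>

lemma tri_sets_laminar:
  assumes "A \<in> tri_sets" "B \<in> tri_sets"
  shows "A \<inter> B = {} \<or> A \<subseteq> B \<or> B \<subseteq> A"
proof (rule ccontr)
  assume neg: "\<not> ?thesis"
  note A = tri_setsD[OF assms(1)] and B = tri_setsD[OF assms(2)]
  have fin: "finite A" "finite B" using A B by auto
  have sub: "A \<inter> B \<subseteq> verts G" "A \<union> B \<subseteq> verts G" "A - B \<subseteq> verts G" "B - A \<subseteq> verts G"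
    using A(1) B(1) by auto
  have ne: "A \<inter> B \<noteq> {}" "A \<union> B \<noteq> {}" "A - B \<noteq> {}" "B - A \<noteq> {}" using neg by auto
  have ne': "A \<inter> B \<noteq> verts G" "A \<union> B \<noteq> verts G" "A - B \<noteq> verts G" "B - A \<noteq> verts G"
    using A(2) B(2) root by auto
  show False
  proof (cases "even (card (A \<inter> B))")
    case True
    have "card (A \<union> B) + card (A \<inter> B) = card A + card B" using card_Un_Int[OF fin] by simp
    then have "even (card (A \<union> B))" using True A(4) B(4) by presburger
    then have "4 \<le> card (edge_cut G (A \<inter> B))" "4 \<le> card (edge_cut G (A \<union> B))"
      using even_card_edge_cut[OF sub(1) ne(1) ne'(1)] even_card_edge_cut[OF sub(2) ne(2) ne'(2)]
        True by auto
    then show False using card_edge_cut_uncross(1)[of A B] A(7) B(7) by linarith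
  next
    case False
    have "card A = card (A \<inter> B) + card (A - B)" "card B = card (A \<inter> B) + card (B - A)"
      using card_Int_Diff[OF fin(1), of B] card_Int_Diff[OF fin(2), of A] by (simp_all add: Int_commute)
    then have "even (card (A - B))" "even (card (B - A))" using False A(4) B(4) by presburger+
    then have "4 \<le> card (edge_cut G (A - B))" "4 \<le> card (edge_cut G (B - A))"
      using even_card_edge_cut[OF sub(3) ne(3) ne'(3)] even_card_edge_cut[OF sub(4) ne(4) ne'(4)]
      by auto
    then show False using card_edge_cut_uncross(2)[of A B] A(7) B(7) by linarith
  qed
qed

lemma verts_neq_singleton: "verts G \<noteq> {v}"
proof
  assume V: "verts G = {v}"
  have "edge_cut G (verts G) = {}" by (auto simp: edge_cut_def)
  moreover have "card (verts G) = 1" unfolding V by simp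
  ultimately show False using odd_card_iff[of "verts G"] by simp
qed

text \<open>A loop at \<open>v\<close> would use up two of the three edge ends and leave at most one
  edge in the cut, against \<open>cut3\<close>.\<close>

lemma card_edge_cut_singleton:
  assumes "v \<in> verts G"
  shows "card (edge_cut G {v}) = 3"
    and "{e \<in> arcs G. tail G e \<in> {v} \<and> head G e \<in> {v}} = {}"
proof -
  have ge: "3 \<le> card (edge_cut G {v})" using cut3[of "{v}"] assms verts_neq_singleton[of v] by blast
  have p: "3 * card {v} =
      2 * card {e \<in> arcs G. tail G e \<in> {v} \<and> head G e \<in> {v}} + card (edge_cut G {v})"
    using assms by (intro cubic_edge_cut_parity[OF cubic]) auto
  show "card (edge_cut G {v}) = 3" using ge p by simp
  then have "card {e \<in> arcs G. tail G e \<in> {v} \<and> head G e \<in> {v}} = 0" using p by simp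
  then show "{e \<in> arcs G. tail G e \<in> {v} \<and> head G e \<in> {v}} = {}" by (subst (asm) card_0_eq) auto
qed

lemma no_loop: "e \<in> arcs G \<Longrightarrow> tail G e \<noteq> head G e"
  using card_edge_cut_singleton(2)[of "tail G e"] by auto

lemma tri_sets_singleton: "v \<in> verts G \<Longrightarrow> v \<noteq> r \<Longrightarrow> {v} \<in> tri_sets"
  unfolding tri_sets_def using card_edge_cut_singleton(1) by auto

text \<open>Equality in \<open>laminar_odd_card\<close>. It passes to the three parts of a split,
  which lets the splitting continue down to singletons.\<close>

definition tight :: "'v set \<Rightarrow> bool" where
  "tight A \<longleftrightarrow> A \<in> tri_sets \<and> 2 * card {B \<in> tri_sets. B \<subseteq> A} + 1 = 3 * card A"

lemma tri_sets_card_le: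
  assumes "A \<in> tri_sets"
  shows "2 * card {B \<in> tri_sets. B \<subseteq> A} + 1 \<le> 3 * card A"
proof -
  have "\<And>x. x \<in> A \<Longrightarrow> {x} \<in> tri_sets" using tri_setsD[OF assms] tri_sets_singleton by auto
  from laminar_odd_card[OF tri_setsD(3)[OF assms] assms tri_sets_laminar tri_setsD(4) this]
  show ?thesis by auto
qed

lemma tight_split:
  assumes "tight A" "card A \<noteq> 1"
  obtains S where "card S = 3" "disjoint S" "\<Union>S = A" "\<And>B. B \<in> S \<Longrightarrow> tight B"
proof -
  have A: "A \<in> tri_sets" "2 * card {B \<in> tri_sets. B \<subseteq> A} + 1 = 3 * card A"
    using assms(1) unfolding tight_def by auto
  have "\<And>x. x \<in> A \<Longrightarrow> {x} \<in> tri_sets" using tri_setsD[OF A(1)] tri_sets_singleton by auto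
  with laminar_odd_card[OF tri_setsD(3)[OF A(1)] A(1) tri_sets_laminar tri_setsD(4)] A(2) assms(2)
  obtain S where "S \<subseteq> tri_sets" "card S = 3" "disjoint S" "\<Union>S = A"
      "\<forall>B\<in>S. 2 * card {C \<in> tri_sets. C \<subseteq> B} + 1 = 3 * card B" by auto
  then show thesis by (intro that[of S]) (auto simp: tight_def)
qed

text \<open>Each pair of parts spans exactly one edge: the three cuts have 9 edges in total, the cut
  of their union has 3, and no pair spans two edges because then their union would have a cut of
  size at most 2.\<close>

lemma tri_sets_split_edges:
  assumes "A \<in> tri_sets" "B \<in> tri_sets" "C \<in> tri_sets"
    and disj: "A \<inter> B = {}" "A \<inter> C = {}" "B \<inter> C = {}" and U: "A \<union> B \<union> C \<in> tri_sets"
  obtains a b c x y z where "distinct [a, b, c, x, y, z]"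
    "edge_cut G (A \<union> B \<union> C) = {a, b, c}" "edge_cut G A = {a, y, z}"
    "edge_cut G B = {b, z, x}" "edge_cut G C = {c, x, y}"
proof -
  let ?A = "edge_cut G A" and ?B = "edge_cut G B" and ?C = "edge_cut G C"
  have c3: "card ?A = 3" "card ?B = 3" "card ?C = 3" "card (edge_cut G (A \<union> B \<union> C)) = 3"
    using tri_setsD(7) assms by auto
  \<comment> \<open>An edge has only two ends, so it cannot meet three disjoint sets.\<close>
  have noABC: "?A \<inter> ?B \<inter> ?C = {}" using disj unfolding edge_cut_def by auto
  have U_eq: "edge_cut G (A \<union> B \<union> C) = (?A - ?B - ?C) \<union> (?B - ?A - ?C) \<union> (?C - ?A - ?B)"
  proof -
    have "(A \<union> B) \<inter> C = {}" using disj by blast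
    then have "edge_cut G (A \<union> B \<union> C) = sym_diff (sym_diff ?A ?B) ?C"
      by (simp only: edge_cut_disjoint_Un edge_cut_disjoint_Un[OF disj(1)])
    then show ?thesis using noABC by blast
  qed
  have inter_le: "card (edge_cut G X \<inter> edge_cut G Y) \<le> 1"
    if XY: "X \<in> tri_sets" "Y \<in> tri_sets" "X \<inter> Y = {}" for X Y
  proof -
    note X = tri_setsD[OF XY(1)] and Y = tri_setsD[OF XY(2)]
    have "edge_cut G (X \<union> Y) = (edge_cut G X - edge_cut G Y) \<union> (edge_cut G Y - edge_cut G X)"
      using edge_cut_disjoint_Un[OF XY(3), of G] by simp
    then have "card (edge_cut G (X \<union> Y)) =
        card (edge_cut G X - edge_cut G Y) + card (edge_cut G Y - edge_cut G X)"
      by (simp only:) (rule card_Un_disjoint; auto)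
    moreover have "3 = card (edge_cut G X \<inter> edge_cut G Y) + card (edge_cut G X - edge_cut G Y)"
      "3 = card (edge_cut G X \<inter> edge_cut G Y) + card (edge_cut G Y - edge_cut G X)"
      using card_Int_Diff[OF finite_edge_cut, of X "edge_cut G Y"]
        card_Int_Diff[OF finite_edge_cut, of Y "edge_cut G X"] X(7) Y(7) by (simp_all add: Int_commute)
    moreover have "3 \<le> card (edge_cut G (X \<union> Y))"
      using cut3[of "X \<union> Y"] X Y root by auto
    ultimately show ?thesis by linarith
  qed
  have le: "card (?B \<inter> ?C) \<le> 1" "card (?A \<inter> ?C) \<le> 1" "card (?A \<inter> ?B) \<le> 1"
    using inter_le assms by auto
  have cA: "card ?A = card (?A - ?B - ?C) + card (?A \<inter> ?B) + card (?A \<inter> ?C)"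
  proof -
    have "?A = (?A - ?B - ?C) \<union> ((?A \<inter> ?B) \<union> (?A \<inter> ?C))" by auto
    also have "card \<dots> = card (?A - ?B - ?C) + card ((?A \<inter> ?B) \<union> (?A \<inter> ?C))"
      by (rule card_Un_disjoint) auto
    also have "card ((?A \<inter> ?B) \<union> (?A \<inter> ?C)) = card (?A \<inter> ?B) + card (?A \<inter> ?C)"
      by (rule card_Un_disjoint) (use noABC in auto)
    finally show ?thesis by simp
  qed
  have cB: "card ?B = card (?B - ?A - ?C) + card (?A \<inter> ?B) + card (?B \<inter> ?C)"
  proof -
    have "?B = (?B - ?A - ?C) \<union> ((?A \<inter> ?B) \<union> (?B \<inter> ?C))" by auto
    also have "card \<dots> = card (?B - ?A - ?C) + card ((?A \<inter> ?B) \<union> (?B \<inter> ?C))"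
      by (rule card_Un_disjoint) auto
    also have "card ((?A \<inter> ?B) \<union> (?B \<inter> ?C)) = card (?A \<inter> ?B) + card (?B \<inter> ?C)"
      by (rule card_Un_disjoint) (use noABC in auto)
    finally show ?thesis by simp
  qed
  have cC: "card ?C = card (?C - ?A - ?B) + card (?A \<inter> ?C) + card (?B \<inter> ?C)"
  proof -
    have "?C = (?C - ?A - ?B) \<union> ((?A \<inter> ?C) \<union> (?B \<inter> ?C))" by auto
    also have "card \<dots> = card (?C - ?A - ?B) + card ((?A \<inter> ?C) \<union> (?B \<inter> ?C))"
      by (rule card_Un_disjoint) auto
    also have "card ((?A \<inter> ?C) \<union> (?B \<inter> ?C)) = card (?A \<inter> ?C) + card (?B \<inter> ?C)"
      by (rule card_Un_disjoint) (use noABC in auto)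
    finally show ?thesis by simp
  qed
  have cU: "card (edge_cut G (A \<union> B \<union> C)) =
      card (?A - ?B - ?C) + card (?B - ?A - ?C) + card (?C - ?A - ?B)"
  proof -
    have "card ((?A - ?B - ?C) \<union> (?B - ?A - ?C) \<union> (?C - ?A - ?B)) =
        card ((?A - ?B - ?C) \<union> (?B - ?A - ?C)) + card (?C - ?A - ?B)"
      by (rule card_Un_disjoint) auto
    also have "card ((?A - ?B - ?C) \<union> (?B - ?A - ?C)) = card (?A - ?B - ?C) + card (?B - ?A - ?C)"
      by (rule card_Un_disjoint) auto
    finally show ?thesis unfolding U_eq .
  qed
  have ones: "card (?B \<inter> ?C) = 1" "card (?A \<inter> ?C) = 1" "card (?A \<inter> ?B) = 1"
    "card (?A - ?B - ?C) = 1" "card (?B - ?A - ?C) = 1" "card (?C - ?A - ?B) = 1"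
    using cA cB cC cU c3 le by linarith+
  \<comment> \<open>Names as in a triangle: \<open>x\<close>, \<open>y\<close>, \<open>z\<close>
    join the two parts other than \<open>A\<close>, \<open>B\<close>, \<open>C\<close> respectively
    and will become the spokes; \<open>a\<close>, \<open>b\<close>, \<open>c\<close> leave the
    union.\<close>
  obtain x where x: "?B \<inter> ?C = {x}" using ones(1) by (auto simp: card_1_singleton_iff)
  obtain y where y: "?A \<inter> ?C = {y}" using ones(2) by (auto simp: card_1_singleton_iff)
  obtain z where z: "?A \<inter> ?B = {z}" using ones(3) by (auto simp: card_1_singleton_iff)
  obtain a where a: "?A - ?B - ?C = {a}" using ones(4) by (auto simp: card_1_singleton_iff)
  obtain b where b: "?B - ?A - ?C = {b}" using ones(5) by (auto simp: card_1_singleton_iff)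
  obtain c where c: "?C - ?A - ?B = {c}" using ones(6) by (auto simp: card_1_singleton_iff)
  show thesis
  proof (rule that)
    show "edge_cut G (A \<union> B \<union> C) = {a, b, c}" unfolding U_eq a b c by auto
    have "?A = (?A - ?B - ?C) \<union> (?A \<inter> ?C) \<union> (?A \<inter> ?B)" by blast
    then show "?A = {a, y, z}" unfolding a y z by auto
    have "?B = (?B - ?A - ?C) \<union> (?A \<inter> ?B) \<union> (?B \<inter> ?C)" by blast
    then show "?B = {b, z, x}" unfolding b z x by auto
    have "?C = (?C - ?A - ?B) \<union> (?B \<inter> ?C) \<union> (?A \<inter> ?C)" by blast
    then show "?C = {c, x, y}" unfolding c x y by auto
    have "a \<in> ?A - ?B - ?C" "b \<in> ?B - ?A - ?C" "c \<in> ?C - ?A - ?B"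
      "x \<in> ?B \<inter> ?C" "y \<in> ?A \<inter> ?C" "z \<in> ?A \<inter> ?B"
      unfolding a b c x y z by simp_all
    then show "distinct [a, b, c, x, y, z]" using noABC by auto
  qed
qed

text \<open>The right-hand side is the count that enters the third coefficient of the flow
  polynomial. Two sets with the same cut have a symmetric difference that misses \<open>r\<close>
  and has an empty cut, hence is empty; and one of the two sides of a cut avoids
  \<open>r\<close>.\<close>

lemma card_tri_sets:
  "card tri_sets = card {T. T \<subseteq> arcs G \<and> card T = 3 \<and> (\<exists>X \<subseteq> verts G. T = edge_cut G X)}"
proof -
  have "inj_on (edge_cut G) tri_sets"
  proof (rule inj_onI)
    fix X Y assume X: "X \<in> tri_sets" and Y: "Y \<in> tri_sets" and eq: "edge_cut G X = edge_cut G Y"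
    have "edge_cut G (sym_diff X Y) = {}" unfolding edge_cut_sym_diff eq by simp
    moreover have "sym_diff X Y \<subseteq> verts G" "sym_diff X Y \<noteq> verts G"
      using tri_setsD[OF X] tri_setsD[OF Y] root by auto
    ultimately have "sym_diff X Y = {}" using cut3[of "sym_diff X Y"] by auto
    then show "X = Y" by auto
  qed
  moreover have "edge_cut G ` tri_sets =
      {T. T \<subseteq> arcs G \<and> card T = 3 \<and> (\<exists>X \<subseteq> verts G. T = edge_cut G X)}" (is "_ = ?R")
  proof
    show "edge_cut G ` tri_sets \<subseteq> ?R" 
    proof
      fix T assume "T \<in> edge_cut G ` tri_sets"
      then obtain X where "X \<in> tri_sets" "T = edge_cut G X" by auto
      then show "T \<in> ?R" using tri_setsD(1,7)[of X] edge_cut_subset[of G X] by auto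
    qed
    show "?R \<subseteq> edge_cut G ` tri_sets"
    proof
      fix T assume "T \<in> ?R"
      then obtain X where X: "X \<subseteq> verts G" "card (edge_cut G X) = 3" "T = edge_cut G X" by auto
      show "T \<in> edge_cut G ` tri_sets"
      proof (cases "r \<in> X")
        case True
        then have "verts G - X \<in> tri_sets" using X edge_cut_Compl[of X] unfolding tri_sets_def by auto
        then show ?thesis using X(3) edge_cut_Compl[of X] by (metis imageI)
      next
        case False
        then have "X \<in> tri_sets" using X unfolding tri_sets_def by auto
        then show ?thesis using X(3) by auto
      qed
    qed
  qed
  ultimately show ?thesis by (metis card_image)
qed

end

section \<open>Counting flows with prescribed support\<close>

text \<open>Flows of the subgraph with edge set \<open>S\<close>, kept as functions on all arcs so
  that different \<open>S\<close> share one function space.\<close>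

definition flows :: "('a, 'm) monoid_scheme \<Rightarrow> ('v, 'e) pre_digraph \<Rightarrow> 'e set \<Rightarrow> ('e \<Rightarrow> 'a) set" where
  "flows A G S = {f \<in> arcs G \<rightarrow>\<^sub>E carrier A. (\<forall>e \<in> arcs G - S. f e = \<one>\<^bsub>A\<^esub>) \<and>
     (\<forall>v \<in> verts G. finprod A f (in_arcs G v) = finprod A f (out_arcs G v))}"

definition adjacency :: "('v, 'e) pre_digraph \<Rightarrow> 'e set \<Rightarrow> ('v \<times> 'v) set" where
  "adjacency G S = {(u, w). \<exists>e \<in> S. tail G e = u \<and> head G e = w \<or> tail G e = w \<and> head G e = u}"

definition linked :: "('v, 'e) pre_digraph \<Rightarrow> 'e set \<Rightarrow> 'v \<Rightarrow> 'v \<Rightarrow> bool" where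
  "linked G S u w \<longleftrightarrow> (u, w) \<in> (adjacency G S)\<^sup>*"

lemma linked_refl [simp]: "linked G S u u"
  by (simp add: linked_def)

lemma sym_adjacency: "sym (adjacency G S)"
  by (auto simp: sym_def adjacency_def)

lemma linked_sym: "linked G S u w \<Longrightarrow> linked G S w u"
  unfolding linked_def by (rule symD[OF sym_rtrancl[OF sym_adjacency]])

lemma linked_trans: "linked G S u v \<Longrightarrow> linked G S v w \<Longrightarrow> linked G S u w"
  unfolding linked_def by (rule rtrancl_trans)

lemma linked_mono: "linked G S u w \<Longrightarrow> S \<subseteq> T \<Longrightarrow> linked G T u w"
  unfolding linked_def by (rule subsetD[OF rtrancl_mono]) (auto simp: adjacency_def)

lemma linked_arc: "e \<in> S \<Longrightarrow> linked G S (tail G e) (head G e)"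
  unfolding linked_def adjacency_def by (rule r_into_rtrancl) auto

lemma linked_invariant:
  assumes "linked G S u w" "\<And>e. e \<in> S \<Longrightarrow> tail G e \<in> X \<longleftrightarrow> head G e \<in> X"
  shows "u \<in> X \<longleftrightarrow> w \<in> X"
  using assms(1) unfolding linked_def
  by (induction rule: rtrancl_induct) (use assms(2) in \<open>auto simp: adjacency_def\<close>)

locale group_flows = fin_digraph G + comm_group A
  for G :: "('v, 'e) pre_digraph" and A :: "('a, 'm) monoid_scheme" (structure) +
  assumes finite_carrier: "finite (carrier A)"
begin

text \<open>The net outflow of \<open>g\<close> is \<open>a\<close> at \<open>u\<close> and its
  inverse at \<open>w\<close>. Writing the two corrections on opposite sides keeps the case
  \<open>u = w\<close> uniform: they cancel, and \<open>g\<close> is a circulation.\<close>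

definition transfers :: "('e \<Rightarrow> 'a) \<Rightarrow> 'v \<Rightarrow> 'v \<Rightarrow> 'a \<Rightarrow> bool" where
  "transfers g u w a \<longleftrightarrow> g \<in> arcs G \<rightarrow> carrier A \<and>
     (\<forall>v \<in> verts G. finprod A g (out_arcs G v) \<otimes> (if v = w then a else \<one>) =
        finprod A g (in_arcs G v) \<otimes> (if v = u then a else \<one>))"

lemma arcs_Pi:
  assumes "g \<in> arcs G \<rightarrow> carrier A"
  shows "g \<in> out_arcs G v \<rightarrow> carrier A" "g \<in> in_arcs G v \<rightarrow> carrier A"
  using assms by auto

lemma transfers_mult:
  assumes g: "transfers g u v a" and h: "transfers h v w a" and a: "a \<in> carrier A"
  shows "transfers (\<lambda>e. g e \<otimes> h e) u w a"
proof -
  have gh: "g \<in> arcs G \<rightarrow> carrier A" "h \<in> arcs G \<rightarrow> carrier A" using g h unfolding transfers_def by auto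
  have "finprod A (\<lambda>e. g e \<otimes> h e) (out_arcs G x) \<otimes> (if x = w then a else \<one>) =
      finprod A (\<lambda>e. g e \<otimes> h e) (in_arcs G x) \<otimes> (if x = u then a else \<one>)" if x: "x \<in> verts G" for x
  proof -
    define go ho gi hi where "go = finprod A g (out_arcs G x)" and "ho = finprod A h (out_arcs G x)"
      and "gi = finprod A g (in_arcs G x)" and "hi = finprod A h (in_arcs G x)"
    define du dv dw where "du = (if x = u then a else \<one>)" and "dv = (if x = v then a else \<one>)"
      and "dw = (if x = w then a else \<one>)"
    have C [simp]: "go \<in> carrier A" "ho \<in> carrier A" "gi \<in> carrier A" "hi \<in> carrier A"
      "du \<in> carrier A" "dv \<in> carrier A" "dw \<in> carrier A"
      unfolding go_def ho_def gi_def hi_def du_def dv_def dw_def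
      using a arcs_Pi[OF gh(1)] arcs_Pi[OF gh(2)] by auto
    have e1: "go \<otimes> dv = gi \<otimes> du" and e2: "ho \<otimes> dw = hi \<otimes> dv"
      using g h x unfolding transfers_def go_def ho_def gi_def hi_def du_def dv_def dw_def by auto
    have "dv \<otimes> (go \<otimes> ho \<otimes> dw) = (go \<otimes> dv) \<otimes> (ho \<otimes> dw)" by (simp add: m_ac)
    also have "\<dots> = (gi \<otimes> du) \<otimes> (hi \<otimes> dv)" unfolding e1 e2 ..
    also have "\<dots> = dv \<otimes> (gi \<otimes> hi \<otimes> du)" by (simp add: m_ac)
    finally have "go \<otimes> ho \<otimes> dw = gi \<otimes> hi \<otimes> du" by simp
    moreover have "finprod A (\<lambda>e. g e \<otimes> h e) (out_arcs G x) = go \<otimes> ho"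
      "finprod A (\<lambda>e. g e \<otimes> h e) (in_arcs G x) = gi \<otimes> hi"
      unfolding go_def ho_def gi_def hi_def using arcs_Pi[OF gh(1)] arcs_Pi[OF gh(2)] by simp_all
    ultimately show ?thesis unfolding du_def dw_def by simp
  qed
  then show ?thesis using gh unfolding transfers_def by auto
qed

lemma finprod_single:
  assumes "finite B" "a \<in> carrier A"
  shows "finprod A (\<lambda>x. if x = e then a else \<one>) B = (if e \<in> B then a else \<one>)"
proof (cases "e \<in> B")
  case True
  then show ?thesis using finprod_singleton_swap[OF True assms(1), of "\<lambda>_. a"] assms(2) by simp
next
  case False
  then show ?thesis by (auto intro!: finprod_one_eqI)
qed

lemma transfers_arc:
  assumes "e \<in> arcs G" "a \<in> carrier A"
  shows "transfers (\<lambda>x. if x = e then a else \<one>) (tail G e) (head G e) a"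
    and "transfers (\<lambda>x. if x = e then inv a else \<one>) (head G e) (tail G e) a"
  using assms unfolding transfers_def
  by (simp_all add: finprod_single finite_in_arcs finite_out_arcs Pi_iff)

text \<open>The transfers along the single edges of a walk add up, even if the walk repeats edges;
  no simple path has to be extracted.\<close>

lemma linked_transfers:
  assumes "linked G S u w" "S \<subseteq> arcs G" "a \<in> carrier A"
  shows "\<exists>g. transfers g u w a \<and> (\<forall>e \<in> arcs G - S. g e = \<one>)"
  using assms(1) unfolding linked_def
proof (induction rule: rtrancl_induct)
  case base
  show ?case by (rule exI[of _ "\<lambda>_. \<one>"]) (simp add: transfers_def)
next
  case (step v w)
  obtain g where g: "transfers g u v a" "\<forall>e \<in> arcs G - S. g e = \<one>" using step.IH by auto
  obtain e where e: "e \<in> S" "tail G e = v \<and> head G e = w \<or> tail G e = w \<and> head G e = v"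
    using step.hyps(2) unfolding adjacency_def by auto
  have eG: "e \<in> arcs G" using e(1) assms(2) by auto
  obtain b where b: "transfers (\<lambda>x. if x = e then b else \<one>) v w a"
    using e(2) transfers_arc[OF eG assms(3)] by auto
  show ?case
    using transfers_mult[OF g(1) b assms(3)] g(2) e(1)
    by (intro exI[of _ "\<lambda>x. g x \<otimes> (if x = e then b else \<one>)"]) auto
qed

lemma flowsD:
  assumes "f \<in> flows A G S"
  shows "f \<in> arcs G \<rightarrow> carrier A" "f \<in> extensional (arcs G)" "\<And>e. e \<in> arcs G \<Longrightarrow> e \<notin> S \<Longrightarrow> f e = \<one>"
    "\<And>v. v \<in> verts G \<Longrightarrow> finprod A f (in_arcs G v) = finprod A f (out_arcs G v)"
  using assms by (simp_all add: flows_def PiE_def)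

lemma finite_flows: "finite (flows A G S)"
proof (rule finite_subset)
  show "flows A G S \<subseteq> arcs G \<rightarrow>\<^sub>E carrier A" unfolding flows_def by blast
  show "finite (arcs G \<rightarrow>\<^sub>E carrier A)" by (rule finite_PiE) (simp_all add: finite_carrier)
qed

lemma flows_mult:
  assumes f: "f \<in> flows A G S" and c: "transfers c u u a" and a: "a \<in> carrier A"
    and supp: "\<And>e. e \<in> arcs G \<Longrightarrow> e \<notin> T \<Longrightarrow> f e \<otimes> c e = \<one>"
  shows "restrict (\<lambda>e. f e \<otimes> c e) (arcs G) \<in> flows A G T"
proof -
  note fD = flowsD[OF f]
  have cC: "c \<in> arcs G \<rightarrow> carrier A" using c unfolding transfers_def by auto
  have ceq: "finprod A c (out_arcs G v) = finprod A c (in_arcs G v)" if "v \<in> verts G" for v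
  proof -
    have "finprod A c (out_arcs G v) \<in> carrier A" "finprod A c (in_arcs G v) \<in> carrier A"
      using arcs_Pi[OF cC] by auto
    then show ?thesis using c that a unfolding transfers_def by (auto split: if_splits)
  qed
  have r: "finprod A (restrict (\<lambda>e. f e \<otimes> c e) (arcs G)) B = finprod A f B \<otimes> finprod A c B"
    if B: "B \<subseteq> arcs G" for B
  proof -
    have P: "f \<in> B \<rightarrow> carrier A" "c \<in> B \<rightarrow> carrier A" using fD(1) cC B by auto
    have "finprod A (restrict (\<lambda>e. f e \<otimes> c e) (arcs G)) B = finprod A (\<lambda>e. f e \<otimes> c e) B"
      by (rule finprod_cong') (use P B in auto)
    then show ?thesis using P by simp
  qed
  have sub: "in_arcs G v \<subseteq> arcs G" "out_arcs G v \<subseteq> arcs G" for v by auto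
  show ?thesis
    unfolding flows_def using fD cC supp ceq r[OF sub(1)] r[OF sub(2)] by auto
qed

text \<open>The new edge closes a cycle with \<open>S\<close>, so for every \<open>a\<close> there
  is a circulation \<open>c a\<close> in \<open>insert e S\<close> with value \<open>a\<close> on
  \<open>e\<close>. A flow on \<open>insert e S\<close> amounts to its value on \<open>e\<close>
  together with a flow on \<open>S\<close>, obtained by cancelling that value with such a
  circulation.\<close>

lemma card_flows_insert_linked:
  assumes S: "S \<subseteq> arcs G" and e: "e \<in> arcs G" "e \<notin> S" and l: "linked G S (tail G e) (head G e)"
  shows "card (flows A G (insert e S)) = card (carrier A) * card (flows A G S)"
proof -
  have "\<exists>c. transfers c (tail G e) (tail G e) a \<and> c e = a \<and> (\<forall>x \<in> arcs G - insert e S. c x = \<one>)"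
    if a: "a \<in> carrier A" for a
  proof -
    obtain h where h: "transfers h (head G e) (tail G e) a" "\<forall>x \<in> arcs G - S. h x = \<one>"
      using linked_transfers[OF linked_sym[OF l] S a] by auto
    have "h e = \<one>" using h(2) e by auto
    then show ?thesis
      using transfers_mult[OF transfers_arc(1)[OF e(1) a] h(1) a] h(2) a \<open>h e = \<one>\<close>
      by (intro exI[of _ "\<lambda>x. (if x = e then a else \<one>) \<otimes> h x"]) auto
  qed
  then obtain c where c: "\<And>a. a \<in> carrier A \<Longrightarrow> transfers (c a) (tail G e) (tail G e) a"
    "\<And>a. a \<in> carrier A \<Longrightarrow> c a e = a"
    "\<And>a x. a \<in> carrier A \<Longrightarrow> x \<in> arcs G \<Longrightarrow> x \<notin> insert e S \<Longrightarrow> c a x = \<one>"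
    by (metis DiffI)
  have cC: "c a x \<in> carrier A" if "a \<in> carrier A" "x \<in> arcs G" for a x
    using c(1)[OF that(1)] that(2) unfolding transfers_def by auto
  define m where "m f a = restrict (\<lambda>x. f x \<otimes> c a x) (arcs G)" for f a
  have inj: "f = g" if "m f a = m g a" "f \<in> flows A G T" "g \<in> flows A G T" "a \<in> carrier A" for f g a T
  proof (rule extensionalityI[of _ "arcs G"])
    fix x assume x: "x \<in> arcs G"
    have "f x \<otimes> c a x = g x \<otimes> c a x" using fun_cong[OF that(1), of x] x unfolding m_def by simp
    moreover have "f x \<in> carrier A" "g x \<in> carrier A"
      using flowsD(1)[OF that(2)] flowsD(1)[OF that(3)] x by auto
    ultimately show "f x = g x" using right_cancel[OF cC[OF that(4) x]] by blast
  qed (use flowsD(2)[OF that(2)] flowsD(2)[OF that(3)] in auto)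
  have "card (carrier A \<times> flows A G S) \<le> card (flows A G (insert e S))"
  proof (rule card_inj_on_le[of "\<lambda>(a, f). m f a"])
    show "inj_on (\<lambda>(a, f). m f a) (carrier A \<times> flows A G S)"
    proof (rule inj_onI, clarify)
      fix a f b g assume *: "a \<in> carrier A" "f \<in> flows A G S" "b \<in> carrier A" "g \<in> flows A G S" "m f a = m g b"
      have "f e = \<one>" "g e = \<one>" using flowsD(3)[OF *(2) e] flowsD(3)[OF *(4) e] by auto
      then have "m f a e = a" "m g b e = b" unfolding m_def using e(1) * c(2) by simp_all
      then have ab: "a = b" using *(5) by simp
      then show "a = b \<and> f = g" using inj *(1,2,4,5) by blast
    qed
    show "(\<lambda>(a, f). m f a) ` (carrier A \<times> flows A G S) \<subseteq> flows A G (insert e S)"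
    proof clarify
      fix a f assume a: "a \<in> carrier A" and f: "f \<in> flows A G S"
      show "m f a \<in> flows A G (insert e S)"
        unfolding m_def
        by (rule flows_mult[OF f c(1)[OF a] a]) (use c(3)[OF a] flowsD(3)[OF f] in auto)
    qed
  qed (rule finite_flows)
  \<comment> \<open>The circulations are picked separately for each value, so
    \<open>c (inv a)\<close> need not be the inverse of \<open>c a\<close>. Hence each direction
    gets its own injection instead of a pair of inverse maps.\<close>
  moreover have "card (flows A G (insert e S)) \<le> card (carrier A \<times> flows A G S)"
  proof (rule card_inj_on_le[of "\<lambda>f. (f e, m f (inv (f e)))"])
    have fe: "f e \<in> carrier A" if "f \<in> flows A G (insert e S)" for f
      using flowsD(1)[OF that] e(1) by auto
    show "inj_on (\<lambda>f. (f e, m f (inv (f e)))) (flows A G (insert e S))"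
      by (rule inj_onI) (use inj fe in \<open>metis inv_closed prod.inject\<close>)
    have "m f (inv (f e)) \<in> flows A G S" if f: "f \<in> flows A G (insert e S)" for f
      unfolding m_def
    proof (rule flows_mult[OF f c(1)])
      show "f x \<otimes> c (inv (f e)) x = \<one>" if x: "x \<in> arcs G" "x \<notin> S" for x
      proof (cases "x = e")
        case True
        then show ?thesis using c(2) fe[OF f] by simp
      next
        case False
        then show ?thesis using c(3)[of "inv (f e)" x] fe[OF f] flowsD(3)[OF f, of x] x by auto
      qed
    qed (use fe[OF f] in simp_all)
    then show "(\<lambda>f. (f e, m f (inv (f e)))) ` flows A G (insert e S) \<subseteq> carrier A \<times> flows A G S"
      using fe by auto
  qed (simp add: finite_flows finite_carrier)
  ultimately show ?thesis by (simp add: card_cartesian_product)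
qed

text \<open>Summing the conservation law over the component of one end of \<open>e\<close>
  leaves only the value of the flow on \<open>e\<close>.\<close>

lemma flows_insert_unlinked:
  assumes S: "S \<subseteq> arcs G" and e: "e \<in> arcs G" "e \<notin> S" and l: "\<not> linked G S (tail G e) (head G e)"
  shows "flows A G (insert e S) = flows A G S"
proof
  show "flows A G S \<subseteq> flows A G (insert e S)" unfolding flows_def by auto
  show "flows A G (insert e S) \<subseteq> flows A G S"
  proof
    fix f assume f: "f \<in> flows A G (insert e S)"
    note fD = flowsD[OF f]
    define X where "X = {v \<in> verts G. linked G S (tail G e) v}"
    define I where "I = {x \<in> arcs G. tail G x \<in> X \<and> head G x \<in> X}"
    define O1 where "O1 = {x \<in> arcs G. tail G x \<in> X \<and> head G x \<notin> X}"
    define O2 where "O2 = {x \<in> arcs G. tail G x \<notin> X \<and> head G x \<in> X}"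
    have X: "X \<subseteq> verts G" unfolding X_def by blast
    have finX: "finite X" by (rule finite_subset[OF X finite_verts])
    have closed: "tail G x \<in> X \<longleftrightarrow> head G x \<in> X" if x: "x \<in> S" for x
    proof -
      have l: "linked G S (tail G x) (head G x)" by (rule linked_arc[OF x])
      have "x \<in> arcs G" using x S by auto
      then show ?thesis
        using linked_trans[OF _ l] linked_trans[OF _ linked_sym[OF l]] unfolding X_def by auto
    qed
    have teX: "tail G e \<in> X" "head G e \<notin> X" using e l unfolding X_def by auto
    have fin: "finite I" "finite O1" "finite O2" unfolding I_def O1_def O2_def by auto
    have P: "f \<in> I \<rightarrow> carrier A" "f \<in> O1 \<rightarrow> carrier A" "f \<in> O2 \<rightarrow> carrier A"
      using fD(1) unfolding I_def O1_def O2_def by auto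
    have "finprod A f (\<Union>(in_arcs G ` X)) = finprod A (\<lambda>v. finprod A f (in_arcs G v)) X"
      using X finX fD(1) by (intro finprod_UN_disjoint) (auto simp: pairwise_def disjnt_def)
    also have "\<dots> = finprod A (\<lambda>v. finprod A f (out_arcs G v)) X"
      by (rule finprod_cong') (use X finX fD(1,4) in \<open>auto intro!: finprod_closed\<close>)
    also have "\<dots> = finprod A f (\<Union>(out_arcs G ` X))"
      using X finX fD(1) by (intro finprod_UN_disjoint[symmetric]) (auto simp: pairwise_def disjnt_def)
    also have "\<Union>(in_arcs G ` X) = I \<union> O2" unfolding I_def O2_def by auto
    also have "\<Union>(out_arcs G ` X) = I \<union> O1" unfolding I_def O1_def by auto
    also have "finprod A f (I \<union> O2) = finprod A f I \<otimes> finprod A f O2"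
      by (rule finprod_Un_disjoint) (use fin P in \<open>auto simp: I_def O2_def\<close>)
    also have "finprod A f (I \<union> O1) = finprod A f I \<otimes> finprod A f O1"
      by (rule finprod_Un_disjoint) (use fin P in \<open>auto simp: I_def O1_def\<close>)
    finally have "finprod A f O2 = finprod A f O1"
      using P by (simp add: finprod_closed)
    moreover have "finprod A f O2 = \<one>"
      by (rule finprod_one_eqI) (use fD(3) closed teX in \<open>auto simp: O2_def\<close>)
    moreover have "finprod A f O1 = f e"
    proof -
      have "finprod A f O1 = finprod A (\<lambda>x. if x = e then f e else \<one>) O1"
        by (rule finprod_cong') (use fD(1,3) closed e in \<open>auto simp: O1_def\<close>)
      also have "\<dots> = f e" using finprod_single[OF fin(2), of "f e" e] fD(1) e teX unfolding O1_def by auto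
      finally show ?thesis .
    qed
    ultimately have "f e = \<one>" by simp
    then show "f \<in> flows A G S" using f unfolding flows_def by auto
  qed
qed

lemma flows_empty: "flows A G {} = {\<lambda>e\<in>arcs G. \<one>}"
proof -
  have "(\<lambda>e\<in>arcs G. \<one>) \<in> flows A G {}"
    unfolding flows_def by (auto intro!: finprod_one_eqI[THEN trans] finprod_one_eqI[symmetric])
  moreover have "f = (\<lambda>e\<in>arcs G. \<one>)" if "f \<in> flows A G {}" for f
    using flowsD(2,3)[OF that] by (intro extensionalityI[of _ "arcs G"]) auto
  ultimately show ?thesis by blast
qed

end

section \<open>Monic polynomials with real roots\<close>

text \<open>These products are reversed monic polynomials: the top coefficients become the bottom
  ones, which are easy to follow by induction. The last identity is Newton's relation between the
  second elementary symmetric function and the power sums.\<close>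

lemma coeff_prod_linear:
  fixes z :: "nat \<Rightarrow> 'a :: {comm_ring_1, semiring_no_zero_divisors}"
  defines "q \<equiv> \<lambda>n. \<Prod>i<n. [:1, - z i:]"
  shows "coeff (q n) 0 = 1" "coeff (q n) 1 = - (\<Sum>i<n. z i)"
    "2 * coeff (q n) 2 = (\<Sum>i<n. z i)\<^sup>2 - (\<Sum>i<n. (z i)\<^sup>2)"
proof -
  have step: "q (Suc n) = q n - smult (z n) (pCons 0 (q n))" for n
    unfolding q_def by (simp add: mult.commute[of "prod _ _"])
  have a: "coeff (q n) 0 = 1 \<and> coeff (q n) 1 = - (\<Sum>i<n. z i)" for n
  proof (induction n)
    case (Suc n)
    then show ?case unfolding step by (simp add: coeff_pCons)
  qed (simp add: q_def)
  then show "coeff (q n) 0 = 1" "coeff (q n) 1 = - (\<Sum>i<n. z i)" by auto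
  show "2 * coeff (q n) 2 = (\<Sum>i<n. z i)\<^sup>2 - (\<Sum>i<n. (z i)\<^sup>2)"
  proof (induction n)
    case (Suc n)
    have "2 * coeff (q (Suc n)) 2 = 2 * coeff (q n) 2 + 2 * z n * (\<Sum>i<n. z i)"
      unfolding step using a[of n] by (simp add: coeff_pCons numeral_2_eq_2 algebra_simps)
    then show ?case unfolding Suc by (simp add: power2_sum algebra_simps)
  qed (simp add: q_def)
qed

text \<open>The right-hand side is the sum of \<open>(z - a)\<^sup>2\<close> over all roots,
  expressed by the top coefficients. Reality of the roots makes each summand nonnegative, so all but
  those of \<open>u\<close> and \<open>v\<close> may be dropped.\<close>

lemma real_roots_sum_squares:
  fixes p :: "complex poly"
  assumes deg: "degree p = r" and monic: "lead_coeff p = 1" and r: "2 \<le> r"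
    and c1: "coeff p (r - 1) = - of_int c" and c2: "2 * coeff p (r - 2) = of_int d"
    and real: "\<And>z. poly p z = 0 \<Longrightarrow> z \<in> \<real>"
    and roots: "poly p (of_int u) = 0" "poly p (of_int v) = 0" "u \<noteq> v"
  shows "(u - a)\<^sup>2 + (v - a)\<^sup>2 \<le> c\<^sup>2 - d - 2 * a * c + int r * a\<^sup>2"
proof -
  obtain z where z: "smult (lead_coeff p) (\<Prod>i<degree p. [:- z i, 1:]) = p"
    using complex_poly_decompose' by blast
  then have p: "p = (\<Prod>i<r. [:- z i, 1:])" using deg monic by simp
  have p0: "poly p x = (\<Prod>i<r. x - z i)" for x unfolding p by (simp add: poly_prod)
  have refl: "reflect_poly p = (\<Prod>i<r. [:1, - z i:])"
  proof -
    have "reflect_poly [:- w, 1:] = [:1, - w:]" for w :: complex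
      by (cases "w = 0") (simp_all add: reflect_poly_pCons reflect_poly_pCons')
    then show ?thesis unfolding p by (simp add: reflect_poly_prod)
  qed
  have "coeff (reflect_poly p) 1 = coeff p (r - 1)" "coeff (reflect_poly p) 2 = coeff p (r - 2)"
    using r deg by (simp_all add: coeff_reflect_poly)
  then have S1: "(\<Sum>i<r. z i) = of_int c" and S2: "(\<Sum>i<r. z i)\<^sup>2 - (\<Sum>i<r. (z i)\<^sup>2) = of_int d"
    using coeff_prod_linear(2,3)[of z r] c1 c2 unfolding refl by auto
  define x where "x i = Re (z i)" for i
  have zx: "z i = of_real (x i)" if "i < r" for i
  proof -
    have "poly p (z i) = 0" unfolding p0 using that by auto
    then show ?thesis using real unfolding x_def by simp
  qed
  have X1: "(\<Sum>i<r. x i) = of_int c"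
  proof -
    have "complex_of_real (\<Sum>i<r. x i) = (\<Sum>i<r. z i)" using zx by simp
    also have "\<dots> = complex_of_real (of_int c)" unfolding S1 by simp
    finally show ?thesis using of_real_eq_iff by blast
  qed
  have X2: "(\<Sum>i<r. (x i)\<^sup>2) = of_int (c\<^sup>2 - d)"
  proof -
    have "complex_of_real (\<Sum>i<r. (x i)\<^sup>2) = (\<Sum>i<r. (z i)\<^sup>2)" using zx by simp
    also have "\<dots> = complex_of_real (of_int (c\<^sup>2 - d))" using S2 unfolding S1 by (simp add: algebra_simps)
    finally show ?thesis using of_real_eq_iff by blast
  qed
  obtain i where i: "i < r" "z i = of_int u" using roots(1) unfolding p0 by auto
  obtain j where j: "j < r" "z j = of_int v" using roots(2) unfolding p0 by auto
  have ij: "i \<noteq> j" using i j roots(3) by auto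
  have "real_of_int ((u - a)\<^sup>2 + (v - a)\<^sup>2) = (\<Sum>k\<in>{i, j}. (x k - of_int a)\<^sup>2)"
    using i j ij unfolding x_def by simp
  also have "\<dots> \<le> (\<Sum>k<r. (x k - of_int a)\<^sup>2)"
    by (rule sum_mono2) (use i j in auto)
  also have "\<dots> = (\<Sum>k<r. (x k)\<^sup>2 - 2 * of_int a * x k + (of_int a)\<^sup>2)"
    by (simp add: power2_diff algebra_simps)
  also have "\<dots> = (\<Sum>k<r. (x k)\<^sup>2) - 2 * of_int a * (\<Sum>k<r. x k) + of_nat r * (of_int a)\<^sup>2"
    by (simp add: sum.distrib sum_subtractf sum_distrib_left)
  also have "\<dots> = real_of_int (c\<^sup>2 - d - 2 * a * c + int r * a\<^sup>2)"
    unfolding X1 X2 by simp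
  finally show ?thesis by (simp only: of_int_le_iff)
qed

text \<open>Separates the bookkeeping of inclusion-exclusion from the graph theory. Only pairs and
  the triples satisfying \<open>Q\<close> reach the exponent \<open>r - 2\<close>, with opposite
  signs; \<open>Q\<close> will say that the triple is an edge cut.\<close>

lemma alternating_subset_poly:
  fixes n :: "'e set \<Rightarrow> nat" and p :: "'a :: comm_ring_1 poly"
  assumes fin: "finite E" and p: "p = (\<Sum>U\<in>Pow E. monom ((-1) ^ card U) (n U))"
    and n0: "n {} = r"
    and n1: "\<And>U. U \<subseteq> E \<Longrightarrow> card U = 1 \<Longrightarrow> n U + 1 = r"
    and n2: "\<And>U. U \<subseteq> E \<Longrightarrow> card U = 2 \<Longrightarrow> n U + 2 = r"
    and n3: "\<And>U. U \<subseteq> E \<Longrightarrow> card U = 3 \<Longrightarrow> if Q U then n U + 2 = r else n U + 3 \<le> r"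
    and n4: "\<And>U. U \<subseteq> E \<Longrightarrow> 4 \<le> card U \<Longrightarrow> n U + 3 \<le> r"
    and r: "2 \<le> r"
  shows "degree p = r" "lead_coeff p = 1" "coeff p (r - 1) = - of_nat (card E)"
    "coeff p (r - 2) = of_nat (card E choose 2) - of_nat (card {U. U \<subseteq> E \<and> card U = 3 \<and> Q U})"
proof -
  have n_cases: "n U = r \<and> U = {} \<or> n U + 1 = r \<and> card U = 1 \<or> n U + 2 = r \<and> card U = 2 \<or>
    n U + 2 = r \<and> card U = 3 \<and> Q U \<or> n U + 3 \<le> r \<and> (card U = 3 \<and> \<not> Q U \<or> 4 \<le> card U)"
    if "U \<subseteq> E" for U
  proof -
    have "finite U" using that fin finite_subset by auto
    consider "card U = 0" | "card U = 1" | "card U = 2" | "card U = 3" | "4 \<le> card U" by linarith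
    then show ?thesis
      using n0 n1[OF that] n2[OF that] n3[OF that] n4[OF that] \<open>finite U\<close> by cases (auto split: if_splits)
  qed
  have n_le: "n U \<le> r" and n_r: "n U = r \<Longrightarrow> U = {}" and n_r1: "n U = r - 1 \<Longrightarrow> card U = 1"
    and n_r2: "n U = r - 2 \<Longrightarrow> card U = 2 \<or> card U = 3 \<and> Q U" if "U \<subseteq> E" for U
    using n_cases[OF that] r by linarith+
  have coeff_p: "coeff p j = (\<Sum>U\<in>{U \<in> Pow E. n U = j}. (-1) ^ card U)" for j
    unfolding p coeff_sum by (simp add: sum.If_cases fin Int_def)
  have "{U \<in> Pow E. n U = r} = {{}}" using n_r n0 by blast
  then have cr: "coeff p r = 1" unfolding coeff_p by simp
  have above: "coeff p j = 0" if "r < j" for j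
  proof -
    have "n U \<noteq> j" if "U \<subseteq> E" for U using n_le[OF that] \<open>r < j\<close> by simp
    then have "{U \<in> Pow E. n U = j} = {}" by auto
    then show ?thesis unfolding coeff_p by (simp only: sum.empty)
  qed
  have nontriv: "(1::'a) \<noteq> 0" by simp
  show deg: "degree p = r"
  proof (rule antisym)
    show "degree p \<le> r" using above by (intro degree_le) auto
    show "r \<le> degree p" using cr nontriv by (intro le_degree) auto
  qed
  show "lead_coeff p = 1" unfolding deg by (rule cr)
  have "{U \<in> Pow E. n U = r - 1} = {U. U \<subseteq> E \<and> card U = 1}"
  proof (intro equalityI subsetI)
    fix U assume "U \<in> {U. U \<subseteq> E \<and> card U = 1}"
    then have "U \<subseteq> E" "n U + 1 = r" using n1 by auto
    then show "U \<in> {U \<in> Pow E. n U = r - 1}" by auto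
  qed (use n_r1 in auto)
  then have "coeff p (r - 1) = (\<Sum>U\<in>{U. U \<subseteq> E \<and> card U = 1}. - 1)"
    unfolding coeff_p by (intro sum.cong) auto
  then show "coeff p (r - 1) = - of_nat (card E)" using n_subsets[OF fin, of 1] by simp
  have split: "{U \<in> Pow E. n U = r - 2} = {U. U \<subseteq> E \<and> card U = 2} \<union> {U. U \<subseteq> E \<and> card U = 3 \<and> Q U}"
  proof (intro equalityI subsetI)
    fix U assume "U \<in> {U. U \<subseteq> E \<and> card U = 2} \<union> {U. U \<subseteq> E \<and> card U = 3 \<and> Q U}"
    then have "U \<subseteq> E" "n U + 2 = r" using n2[of U] n3[of U] by auto
    then show "U \<in> {U \<in> Pow E. n U = r - 2}" by auto
  qed (use n_r2 in auto)
  have "coeff p (r - 2) = (\<Sum>U\<in>{U. U \<subseteq> E \<and> card U = 2}. (-1) ^ card U) +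
      (\<Sum>U\<in>{U. U \<subseteq> E \<and> card U = 3 \<and> Q U}. (-1) ^ card U)"
    unfolding coeff_p split by (rule sum.union_disjoint) (use fin in auto)
  also have "(\<Sum>U\<in>{U. U \<subseteq> E \<and> card U = 2}. (-1) ^ card U) = (\<Sum>U\<in>{U. U \<subseteq> E \<and> card U = 2}. 1 :: 'a)"
    by (rule sum.cong) auto
  also have "(\<Sum>U\<in>{U. U \<subseteq> E \<and> card U = 3 \<and> Q U}. (-1) ^ card U) =
      (\<Sum>U\<in>{U. U \<subseteq> E \<and> card U = 3 \<and> Q U}. - 1 :: 'a)"
    by (rule sum.cong) auto
  finally show "coeff p (r - 2) = of_nat (card E choose 2) - of_nat (card {U. U \<subseteq> E \<and> card U = 3 \<and> Q U})"
    using n_subsets[OF fin, of 2] by simp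
qed

section \<open>The flow polynomial\<close>

text \<open>One group of every positive order: enough to determine the flow polynomial, and to test
  its values at 1 and 2.\<close>

definition add_mod :: "nat \<Rightarrow> nat monoid" where
  "add_mod n = \<lparr>carrier = {..<n}, mult = (\<lambda>x y. (x + y) mod n), one = 0\<rparr>"

lemma add_mod_simps [simp]:
  "carrier (add_mod n) = {..<n}" "x \<otimes>\<^bsub>add_mod n\<^esub> y = (x + y) mod n" "\<one>\<^bsub>add_mod n\<^esub> = 0"
  by (simp_all add: add_mod_def)

lemma comm_group_add_mod:
  assumes "0 < n"
  shows "comm_group (add_mod n)"
proof (rule comm_groupI)
  fix x assume "x \<in> carrier (add_mod n)"
  then show "\<exists>y\<in>carrier (add_mod n). y \<otimes>\<^bsub>add_mod n\<^esub> x = \<one>\<^bsub>add_mod n\<^esub>"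
    using assms by (intro bexI[of _ "if x = 0 then 0 else n - x"]) auto
qed (use assms in \<open>auto simp: mod_simps ac_simps\<close>)

text \<open>The dimension of the cycle space of the subgraph with edge set \<open>S\<close>, read
  off over the two-element group; \<open>card_flows\<close> shows that the same exponent serves
  every finite abelian group.\<close>

definition nullity :: "('v, 'e) pre_digraph \<Rightarrow> 'e set \<Rightarrow> nat" where
  "nullity G S = (THE n. card (flows (add_mod 2) G S) = 2 ^ n)"

context fin_digraph
begin

lemma finite_arcs_subset: "S \<subseteq> arcs G \<Longrightarrow> finite S"
  by (rule finite_subset[OF _ finite_arcs])

lemma group_flowsI: "comm_group A \<Longrightarrow> finite (carrier A) \<Longrightarrow> group_flows G A"
  by (simp add: group_flows_def group_flows_axioms_def fin_digraph_axioms)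

text \<open>The order of the quantifiers is the point. Whether an added edge multiplies the number
  of flows by the group order or leaves it unchanged depends only on the graph, so one exponent
  works for all groups.\<close>

lemma ex_nullity:
  assumes "S \<subseteq> arcs G"
  shows "\<exists>n. \<forall>A :: nat monoid. comm_group A \<and> finite (carrier A) \<longrightarrow>
    card (flows A G S) = card (carrier A) ^ n"
  using finite_subset[OF assms finite_arcs] assms
proof (induction S rule: finite_induct)
  case empty
  show ?case
    by (intro exI[of _ 0] allI impI) (simp add: group_flows.flows_empty[OF group_flowsI])
next
  case (insert e S)
  then obtain n where n: "\<And>A :: nat monoid. comm_group A \<Longrightarrow> finite (carrier A) \<Longrightarrow>
    card (flows A G S) = card (carrier A) ^ n" by auto
  have S: "S \<subseteq> arcs G" "e \<in> arcs G" using insert.prems by auto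
  show ?case
  proof (cases "linked G S (tail G e) (head G e)")
    case True
    show ?thesis
    proof (intro exI[of _ "Suc n"] allI impI)
      fix A :: "nat monoid" assume A: "comm_group A \<and> finite (carrier A)"
      then interpret group_flows G A by (intro group_flowsI) auto
      show "card (flows A G (insert e S)) = card (carrier A) ^ Suc n"
        using card_flows_insert_linked[OF S insert.hyps(2) True] n A by simp
    qed
  next
    case False
    show ?thesis
    proof (intro exI[of _ n] allI impI)
      fix A :: "nat monoid" assume A: "comm_group A \<and> finite (carrier A)"
      then interpret group_flows G A by (intro group_flowsI) auto
      show "card (flows A G (insert e S)) = card (carrier A) ^ n"
        using flows_insert_unlinked[OF S insert.hyps(2) False] n A by simp
    qed
  qed
qed

lemma card_flows:
  fixes A :: "nat monoid"
  assumes "S \<subseteq> arcs G" "comm_group A" "finite (carrier A)"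
  shows "card (flows A G S) = card (carrier A) ^ nullity G S"
proof -
  obtain n where n: "\<And>A :: nat monoid. comm_group A \<Longrightarrow> finite (carrier A) \<Longrightarrow>
    card (flows A G S) = card (carrier A) ^ n" using ex_nullity[OF assms(1)] by auto
  have "card (flows (add_mod 2) G S) = 2 ^ n"
    using n[OF comm_group_add_mod[of 2]] by simp
  then have "nullity G S = n" unfolding nullity_def by (intro the_equality) auto
  then show ?thesis using n assms by auto
qed

lemma nullity_insert:
  assumes "S \<subseteq> arcs G" "e \<in> arcs G" "e \<notin> S"
  shows "nullity G (insert e S) = nullity G S + (if linked G S (tail G e) (head G e) then 1 else 0)"
proof -
  interpret group_flows G "add_mod 2" by (rule group_flowsI) (simp_all add: comm_group_add_mod)
  have c: "card (flows (add_mod 2) G T) = 2 ^ nullity G T" if "T \<subseteq> arcs G" for T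
    using card_flows[OF that, of "add_mod 2"] comm_group_add_mod[of 2] by simp
  have "(2::nat) ^ nullity G (insert e S) =
      2 ^ (nullity G S + (if linked G S (tail G e) (head G e) then 1 else 0))"
    using card_flows_insert_linked[OF assms] flows_insert_unlinked[OF assms] c[of S] c[of "insert e S"] assms
    by (auto simp: power_add)
  then show ?thesis by simp
qed

lemma nullity_empty: "nullity G {} = 0"
proof -
  interpret group_flows G "add_mod 2" by (rule group_flowsI) (simp_all add: comm_group_add_mod)
  have one: "card (flows (add_mod 2) G {}) = 1" by (simp add: flows_empty)
  show ?thesis
    unfolding nullity_def one
  proof (rule the_equality)
    fix n assume "(1::nat) = 2 ^ n"
    then show "n = 0" by (cases n) auto
  qed simp
qed

lemma nullity_mono:
  assumes "S \<subseteq> T" "T \<subseteq> arcs G"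
  shows "nullity G S \<le> nullity G T"
proof -
  have "finite D \<Longrightarrow> D \<subseteq> arcs G \<Longrightarrow> nullity G S \<le> nullity G (S \<union> D)" for D
  proof (induction D rule: finite_induct)
    case (insert e D)
    show ?case
    proof (cases "e \<in> S")
      case True
      then show ?thesis using insert by (simp add: insert_absorb)
    next
      case False
      have "S \<union> D \<subseteq> arcs G" "e \<in> arcs G" "e \<notin> S \<union> D" using insert False assms by auto
      then have "nullity G (S \<union> D) \<le> nullity G (insert e (S \<union> D))" using nullity_insert by simp
      then show ?thesis using insert by simp
    qed
  qed simp
  from this[of T] show ?thesis using assms finite_arcs_subset[OF assms(2)] by (simp add: Un_absorb1)
qed

text \<open>Inclusion-exclusion over the set \<open>U\<close> of edges on which the flow is forced
  to vanish.\<close>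

definition flow_sum :: "complex poly" where
  "flow_sum = (\<Sum>U\<in>Pow (arcs G). monom ((-1) ^ card U) (nullity G (arcs G - U)))"

lemma poly_flow_sum:
  fixes A :: "nat monoid"
  assumes A: "comm_group A" "finite (carrier A)"
  shows "poly flow_sum (of_nat (card (carrier A))) = of_nat (card (nz_flows A G))"
proof -
  interpret group_flows G A by (rule group_flowsI[OF A])
  let ?E = "arcs G"
  define supp where "supp f = {e \<in> ?E. f e \<noteq> \<one>\<^bsub>A\<^esub>}" for f :: "'b \<Rightarrow> nat"
  define F :: "'b set \<Rightarrow> complex" where "F T = of_nat (card {f \<in> flows A G ?E. supp f = T})" for T
  \<comment> \<open>\<open>F\<close> counts flows by exact support and \<open>H\<close> by an upper
    bound on the support. The inversion theorem wants their relation on all finite sets, not only on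
    sets of arcs; hence the intersection.\<close>
  define H :: "'b set \<Rightarrow> complex" where "H T = of_nat (card (flows A G (T \<inter> ?E)))" for T
  have "H S = sum F (Pow S)" if "finite S" for S
  proof -
    have "flows A G (S \<inter> ?E) = (\<Union>T\<in>Pow S. {f \<in> flows A G ?E. supp f = T})"
      unfolding flows_def supp_def by auto
    then have "card (flows A G (S \<inter> ?E)) = (\<Sum>T\<in>Pow S. card {f \<in> flows A G ?E. supp f = T})"
      by (simp only:) (rule card_UN_disjoint; use that finite_flows in auto)
    then show ?thesis unfolding H_def F_def by simp
  qed
  from inclusion_exclusion_mobius[of H F, OF this finite_arcs]
  have "F ?E = (\<Sum>T\<in>Pow ?E. (-1) ^ (card ?E - card T) * H T)" .
  also have "\<dots> = (\<Sum>U\<in>Pow ?E. (-1) ^ card U * H (?E - U))"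
    by (rule sum.reindex_bij_witness[of _ "\<lambda>U. ?E - U" "\<lambda>T. ?E - T"])
      (auto simp: double_diff card_Diff_subset finite_subset[OF _ finite_arcs])
  also have "\<dots> = poly flow_sum (of_nat (card (carrier A)))"
  proof -
    have "H (?E - U) = of_nat (card (carrier A)) ^ nullity G (?E - U)" for U
      unfolding H_def using card_flows[OF _ A, of "?E - U"] by (simp add: Int_absorb2)
    then show ?thesis unfolding flow_sum_def by (simp add: poly_sum poly_monom)
  qed
  also have "{f \<in> flows A G ?E. supp f = ?E} = nz_flows A G"
    unfolding flows_def nz_flows_def supp_def by (auto simp: PiE_iff)
  ultimately show ?thesis unfolding F_def by simp
qed

lemma flow_poly_eq: "flow_poly G = flow_sum"
  unfolding flow_poly_def
proof (rule the_equality)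
  show "\<forall>A :: nat monoid. comm_group A \<and> finite (carrier A) \<longrightarrow>
      poly flow_sum (of_nat (card (carrier A))) = of_nat (card (nz_flows A G))"
    using poly_flow_sum by blast
  fix p :: "complex poly"
  assume p: "\<forall>A :: nat monoid. comm_group A \<and> finite (carrier A) \<longrightarrow>
      poly p (of_nat (card (carrier A))) = of_nat (card (nz_flows A G))"
  have eq: "poly p (of_nat n) = poly flow_sum (of_nat n)" if "0 < n" for n
    using p poly_flow_sum[OF comm_group_add_mod[OF that]] comm_group_add_mod[OF that]
    by (metis add_mod_simps(1) card_lessThan finite_lessThan)
  have "of_nat ` {0<..} \<subseteq> {z. poly (p - flow_sum) z = 0}" using eq by auto
  moreover have "infinite (of_nat ` {0<..} :: complex set)"
  proof
    assume "finite (of_nat ` {0<..} :: complex set)"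
    then have "finite {0::nat<..}" by (rule finite_imageD) (simp add: inj_on_def)
    then show False by (simp add: infinite_Ioi)
  qed
  ultimately have "p - flow_sum = 0" using poly_roots_finite finite_subset by blast
  then show "p = flow_sum" by simp
qed

end

section \<open>Nullity after deleting edges\<close>

context edge_connected_cubic
begin

text \<open>The component of \<open>u\<close> after deleting \<open>U\<close> is such a set: only
  deleted edges can leave it.\<close>

lemma unlinked_cut:
  assumes "\<not> linked G (arcs G - U) u w" "u \<in> verts G" "w \<in> verts G" "finite U"
  obtains X where "X \<subseteq> verts G" "edge_cut G X \<subseteq> U" "3 \<le> card (edge_cut G X)"
proof -
  define X where "X = {v \<in> verts G. linked G (arcs G - U) u v}"
  have X: "X \<subseteq> verts G" "X \<noteq> {}" "X \<noteq> verts G" unfolding X_def using assms by auto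
  have "edge_cut G X \<subseteq> U"
  proof
    fix x assume x: "x \<in> edge_cut G X"
    show "x \<in> U"
    proof (rule ccontr)
      assume "x \<notin> U"
      then have "linked G (arcs G - U) (tail G x) (head G x)"
        using x by (intro linked_arc) (auto simp: edge_cut_def)
      then show False
        using x linked_trans linked_sym unfolding X_def edge_cut_def by (fastforce dest: wellformed)
    qed
  qed
  then show thesis using that X cut3 by blast
qed

lemma nullity_remove:
  assumes "U \<subseteq> arcs G" "e \<in> U"
  shows "nullity G (arcs G - (U - {e})) = nullity G (arcs G - U) +
    (if linked G (arcs G - U) (tail G e) (head G e) then 1 else 0)"
proof -
  have "arcs G - (U - {e}) = insert e (arcs G - U)" using assms by auto
  then show ?thesis using nullity_insert[of "arcs G - U" e] assms by auto
qed

lemma linked_remove: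
  assumes "U \<subseteq> arcs G" "card U \<le> 2" "u \<in> verts G" "w \<in> verts G"
  shows "linked G (arcs G - U) u w"
proof (rule ccontr)
  have fin: "finite U" by (rule finite_arcs_subset[OF assms(1)])
  assume "\<not> ?thesis"
  from unlinked_cut[OF this assms(3,4) fin] obtain X where X: "edge_cut G X \<subseteq> U" "3 \<le> card (edge_cut G X)" .
  show False using card_mono[OF fin X(1)] X(2) assms(2) by linarith
qed

lemma nullity_remove_le2:
  assumes "U \<subseteq> arcs G" "card U \<le> 2"
  shows "nullity G (arcs G - U) + card U = nullity G (arcs G)"
proof -
  have "finite U" by (rule finite_arcs_subset[OF assms(1)])
  then show ?thesis using assms
  proof (induction U rule: finite_induct)
    case (insert e U)
    have "nullity G (arcs G - (insert e U - {e})) = nullity G (arcs G - insert e U) + 1"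
      using nullity_remove[of "insert e U" e] linked_remove[of "insert e U" "tail G e" "head G e"] insert
      by auto
    then show ?case using insert by simp
  qed simp
qed

text \<open>The first two deletions lower the nullity by one each. The third does so too unless the
  ends of its edge become separated; the separating cut then lies in \<open>U\<close> and has at
  least three edges, so it is \<open>U\<close>.\<close>

lemma nullity_remove_3:
  assumes U: "U \<subseteq> arcs G" "card U = 3"
  shows "if \<exists>X\<subseteq>verts G. U = edge_cut G X then nullity G (arcs G - U) + 2 = nullity G (arcs G)
    else nullity G (arcs G - U) + 3 = nullity G (arcs G)"
proof -
  have fin: "finite U" by (rule finite_arcs_subset[OF U(1)])
  obtain e where e: "e \<in> U" using U(2) by fastforce
  have eG: "e \<in> arcs G" using e U(1) by auto
  have two: "nullity G (arcs G - (U - {e})) + 2 = nullity G (arcs G)"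
    using nullity_remove_le2[of "U - {e}"] U e fin by auto
  define P where "P \<longleftrightarrow> (\<exists>X\<subseteq>verts G. U = edge_cut G X)"
  have l: "linked G (arcs G - U) (tail G e) (head G e) \<longleftrightarrow> \<not> P"
    unfolding P_def
  proof
    assume l: "linked G (arcs G - U) (tail G e) (head G e)"
    show "\<not> (\<exists>X\<subseteq>verts G. U = edge_cut G X)"
    proof
      assume "\<exists>X\<subseteq>verts G. U = edge_cut G X"
      then obtain X where X: "U = edge_cut G X" by auto
      have "tail G e \<in> X \<longleftrightarrow> head G e \<in> X"
        by (rule linked_invariant[OF l]) (auto simp: X edge_cut_def)
      then show False using e unfolding X edge_cut_def by auto
    qed
  next
    assume nX: "\<not> (\<exists>X\<subseteq>verts G. U = edge_cut G X)"
    show "linked G (arcs G - U) (tail G e) (head G e)"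
    proof (rule ccontr)
      assume n: "\<not> ?thesis"
      obtain X where X: "X \<subseteq> verts G" "edge_cut G X \<subseteq> U" "3 \<le> card (edge_cut G X)"
        by (rule unlinked_cut[OF n _ _ fin]) (use eG in auto)
      then have "edge_cut G X = U" using card_subset_eq[OF fin X(2)] card_mono[OF fin X(2)] U(2) by auto
      then show False using nX X(1) by auto
    qed
  qed
  show ?thesis
    using nullity_remove[OF U(1) e] two unfolding P_def[symmetric] l by (cases P) simp_all
qed

text \<open>Two 3-edge-cuts sharing two edges would have a symmetric difference of size 2.\<close>

lemma nullity_remove_ge4:
  assumes U: "U \<subseteq> arcs G" "4 \<le> card U"
  shows "nullity G (arcs G - U) + 3 \<le> nullity G (arcs G)"
proof -
  obtain W where W: "W \<subseteq> U" "card W = 4" using obtain_subset_with_card_n[OF U(2)] by metis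
  \<comment> \<open>By monotonicity it is enough to find three deleted edges that do not form a
    cut.\<close>
  obtain T where T: "T \<subseteq> W" "card T = 3" "\<not> (\<exists>X\<subseteq>verts G. T = edge_cut G X)"
  proof (rule ccontr)
    assume "\<not> thesis"
    then have all: "\<exists>X\<subseteq>verts G. T = edge_cut G X" if "T \<subseteq> W" "card T = 3" for T
      using that \<open>\<And>T. T \<subseteq> W \<Longrightarrow> card T = 3 \<Longrightarrow> \<not> (\<exists>X\<subseteq>verts G. T = edge_cut G X) \<Longrightarrow> thesis\<close> by blast
    have finW: "finite W" using W(2) card.infinite by fastforce
    obtain c where c: "c \<in> W" using W(2) by fastforce
    obtain d where d: "d \<in> W" "d \<noteq> c"
    proof -
      have "card (W - {c}) = 3" using W(2) c finW by simp
      then have "W - {c} \<noteq> {}" by (metis card.empty zero_neq_numeral)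
      then show thesis using that by auto
    qed
    have "card (W - {c}) = 3" "card (W - {d}) = 3" using W(2) c d finW by auto
    then obtain X Y where X: "X \<subseteq> verts G" "W - {c} = edge_cut G X" and Y: "Y \<subseteq> verts G" "W - {d} = edge_cut G Y"
      using all[of "W - {c}"] all[of "W - {d}"] by auto
    have cut: "edge_cut G (sym_diff X Y) = {c, d}"
      unfolding edge_cut_sym_diff X(2)[symmetric] Y(2)[symmetric] using c d by auto
    have "sym_diff X Y \<noteq> {}" using cut by (metis edge_cut_empty insert_not_empty)
    moreover have "sym_diff X Y \<noteq> verts G"
    proof
      assume "sym_diff X Y = verts G"
      then have "edge_cut G (sym_diff X Y) = {}" by (auto simp: edge_cut_def)
      then show False using cut by auto
    qed
    ultimately have "3 \<le> card (edge_cut G (sym_diff X Y))" using X(1) Y(1) by (intro cut3) auto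
    then show False unfolding cut using d by simp
  qed
  have "nullity G (arcs G - U) \<le> nullity G (arcs G - T)"
    by (rule nullity_mono) (use T(1) W(1) in auto)
  moreover have "T \<subseteq> arcs G" using T(1) W(1) U(1) by auto
  ultimately show ?thesis using nullity_remove_3[OF \<open>T \<subseteq> arcs G\<close> T(2)] T(3) by auto
qed

text \<open>A tree grown from \<open>r\<close> one vertex at a time. The cut of the current vertex
  set \<open>X\<close> supplies the next edge; all edges of \<open>S\<close> stay inside
  \<open>X\<close>, so its ends are unlinked and the nullity remains 0.\<close>

lemma spanning_tree_arcs:
  assumes "1 \<le> k" "k \<le> card (verts G)"
  shows "\<exists>X S. card X = k \<and> X \<subseteq> verts G \<and> S \<subseteq> arcs G \<and> (\<forall>e\<in>S. tail G e \<in> X \<and> head G e \<in> X) \<and>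
    card S + 1 = k \<and> nullity G S = 0 \<and> (\<forall>u\<in>X. \<forall>w\<in>X. linked G S u w)"
  using assms
proof (induction k rule: dec_induct)
  case base
  show ?case using root nullity_empty by (intro exI[of _ "{r}"] exI[of _ "{}"]) auto
next
  case (step k)
  then obtain X S where XS: "card X = k" "X \<subseteq> verts G" "S \<subseteq> arcs G" "\<And>e. e \<in> S \<Longrightarrow> tail G e \<in> X \<and> head G e \<in> X"
    "card S + 1 = k" "nullity G S = 0" "\<And>u w. u \<in> X \<Longrightarrow> w \<in> X \<Longrightarrow> linked G S u w" by auto
  have fin: "finite X" "finite S"
    using finite_subset[OF XS(2) finite_verts] finite_arcs_subset[OF XS(3)] by auto
  have "X \<noteq> {}" "X \<noteq> verts G" using XS(1) step by auto
  then have "3 \<le> card (edge_cut G X)" using cut3 XS(2) by auto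
  then obtain e where e: "e \<in> edge_cut G X" by fastforce
  then have eG: "e \<in> arcs G" "e \<notin> S" using XS(4) unfolding edge_cut_def by auto
  obtain u v where uv: "u \<in> X" "v \<notin> X" "v \<in> verts G" "{tail G e, head G e} = {u, v}"
  proof (cases "tail G e \<in> X")
    case True
    then show thesis using that[of "tail G e" "head G e"] e eG(1) unfolding edge_cut_def by auto
  next
    case False
    then show thesis
      using that[of "head G e" "tail G e"] e eG(1) unfolding edge_cut_def by (auto simp: insert_commute)
  qed
  have nl: "\<not> linked G S (tail G e) (head G e)"
    using linked_invariant[of G S "tail G e" "head G e" X] XS(4) e unfolding edge_cut_def by auto
  have luv: "linked G (insert e S) u v"
    using linked_arc[of e "insert e S" G] linked_sym[of G "insert e S" "tail G e" "head G e"] uv(4)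
    by (auto simp: doubleton_eq_iff)
  have lXX: "linked G (insert e S) a b" if "a \<in> X" "b \<in> X" for a b
    using linked_mono[OF XS(7)[OF that]] by auto
  have lXv: "linked G (insert e S) a v" if "a \<in> X" for a
    using linked_trans[OF lXX[OF that uv(1)] luv] .
  have "linked G (insert e S) a b" if "a \<in> insert v X" "b \<in> insert v X" for a b
    using that lXX lXv linked_sym by (metis insertE linked_refl)
  then show ?case
    using XS uv eG fin nullity_insert[OF XS(3) eG] nl
    by (intro exI[of _ "insert v X"] exI[of _ "insert e S"]) (auto simp: doubleton_eq_iff)
qed

text \<open>The cyclomatic number: beyond a spanning tree, every further edge has linked ends and
  raises the nullity by one.\<close>

lemma nullity_arcs: "nullity G (arcs G) + card (verts G) = card (arcs G) + 1"
proof -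
  have "1 \<le> card (verts G)" using root card_gt_0_iff[of "verts G"] by auto
  from spanning_tree_arcs[OF this order_refl]
  obtain X S where XS: "card X = card (verts G)" "X \<subseteq> verts G" "S \<subseteq> arcs G" "card S + 1 = card (verts G)"
    "nullity G S = 0" "\<And>u w. u \<in> X \<Longrightarrow> w \<in> X \<Longrightarrow> linked G S u w" by auto
  have X: "X = verts G" using card_subset_eq[OF finite_verts XS(2,1)] .
  have fin: "finite S" by (rule finite_arcs_subset[OF XS(3)])
  have "nullity G (S \<union> R) = card R" if "R \<subseteq> arcs G - S" for R
  proof -
    have "finite R" by (rule finite_arcs_subset) (use that in auto)
    then show ?thesis using that
    proof (induction R rule: finite_induct)
      case (insert e R)
      have "linked G (S \<union> R) (tail G e) (head G e)"
        by (rule linked_mono[of G S]) (use insert XS(6) X in auto)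
      then show ?case using nullity_insert[of "S \<union> R" e] insert XS(3) by auto
    qed (simp add: XS(5))
  qed
  from this[of "arcs G - S"] have "nullity G (arcs G) = card (arcs G) - card S"
    using XS(3) fin by (simp add: Un_absorb1 card_Diff_subset)
  moreover have "card S \<le> card (arcs G)" using XS(3) by (simp add: card_mono)
  ultimately show ?thesis using XS(4) by linarith
qed

text \<open>The trivial group has no nonzero value, and there is an edge that would need
  one.\<close>

lemma nz_flows_1: "nz_flows (add_mod 1) G = {}"
proof -
  have "card (edge_cut G {r}) = 3" by (rule card_edge_cut_singleton[OF root])
  then have "arcs G \<noteq> {}" by (auto simp: edge_cut_def)
  then show ?thesis by (auto simp: nz_flows_def PiE_iff)
qed

text \<open>Over the group of order 2 a nowhere-zero flow would be constant, but every degree is odd.\<close>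

lemma nz_flows_2: "nz_flows (add_mod 2) G = {}"
proof (rule ccontr)
  assume "\<not> ?thesis"
  then obtain f where f: "f \<in> nz_flows (add_mod 2) G" by auto
  interpret comm_group "add_mod 2" by (rule comm_group_add_mod) simp
  have f1: "f e = 1" if "e \<in> arcs G" for e
    using f that unfolding nz_flows_def by (auto simp: PiE_iff)
  have fin: "finprod (add_mod 2) f B = card B mod 2" if "finite B" "B \<subseteq> arcs G" for B
    using that
  proof (induction B rule: finite_induct)
    case (insert e B)
    then show ?case using f1 by (subst finprod_insert) (auto simp: Pi_iff subset_iff mod_simps)
  qed simp
  have "finprod (add_mod 2) f (in_arcs G r) = finprod (add_mod 2) f (out_arcs G r)"
    using f root unfolding nz_flows_def by auto
  moreover have "in_arcs G r \<subseteq> arcs G" "out_arcs G r \<subseteq> arcs G" by auto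
  ultimately have "in_degree G r mod 2 = out_degree G r mod 2"
    using fin[OF finite_in_arcs] fin[OF finite_out_arcs] unfolding in_degree_def out_degree_def by simp
  moreover have "in_degree G r + out_degree G r = 3" using cubic root unfolding cubic_def by auto
  ultimately show False by presburger
qed

theorem card_tri_sets_ge:
  assumes "flow_roots G \<subseteq> \<real>"
  shows "3 * card (verts G) \<le> 2 * card tri_sets + 4"
proof -
  define n m where "n = card (verts G)" and "m = card (arcs G)"
  define k where "k = nullity G (arcs G)"
  define t where "t = card tri_sets"
  have "edge_cut G (verts G) = {}" by (auto simp: edge_cut_def)
  moreover have "{e \<in> arcs G. tail G e \<in> verts G \<and> head G e \<in> verts G} = arcs G" by auto
  ultimately have nm: "3 * n = 2 * m"
    using cubic_edge_cut_parity[OF cubic, of "verts G"] unfolding n_def m_def by simp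
  have kn: "k + n = m + 1" unfolding k_def n_def m_def by (rule nullity_arcs)
  have "n \<noteq> 0" unfolding n_def using root by auto
  moreover have "2 * k = n + 2" using kn nm by linarith
  ultimately have k2: "2 \<le> k" by linarith
  let ?Q = "\<lambda>U. \<exists>X\<subseteq>verts G. U = edge_cut G X"
  have Q: "card {U. U \<subseteq> arcs G \<and> card U = 3 \<and> ?Q U} = t" unfolding t_def card_tri_sets ..
  have n1: "nullity G (arcs G - U) + 1 = k" if "U \<subseteq> arcs G" "card U = 1" for U
    using nullity_remove_le2[OF that(1)] that(2) unfolding k_def by simp
  have n2: "nullity G (arcs G - U) + 2 = k" if "U \<subseteq> arcs G" "card U = 2" for U
    using nullity_remove_le2[OF that(1)] that(2) unfolding k_def by simp
  have n3: "if ?Q U then nullity G (arcs G - U) + 2 = k else nullity G (arcs G - U) + 3 \<le> k"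
    if "U \<subseteq> arcs G" "card U = 3" for U
    using nullity_remove_3[OF that] unfolding k_def by (simp split: if_splits)
  have n4: "nullity G (arcs G - U) + 3 \<le> k" if "U \<subseteq> arcs G" "4 \<le> card U" for U
    using nullity_remove_ge4[OF that] unfolding k_def .
  have n0: "nullity G (arcs G - {}) = k" unfolding k_def by simp
  note coeffs = alternating_subset_poly[OF finite_arcs flow_sum_def n0 n1 n2 n3 n4 k2]
  have *: "coeff flow_sum (k - 1) = - of_nat m" "coeff flow_sum (k - 2) = of_nat (m choose 2) - of_nat t"
    using coeffs(3,4) unfolding Q m_def by blast+
  have real: "z \<in> \<real>" if "poly flow_sum z = 0" for z
    using assms that unfolding flow_roots_def flow_poly_eq by auto
  have root: "poly flow_sum (of_nat j) = 0" if "0 < j" "nz_flows (add_mod j) G = {}" for j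
    using poly_flow_sum[OF comm_group_add_mod[OF that(1)]] that(2) by simp
  have c2: "2 * coeff flow_sum (k - 2) = of_int (int m * (int m - 1) - 2 * int t)"
  proof -
    have "int (m * (m - 1)) = int m * (int m - 1)" by (cases m) (auto simp: algebra_simps)
    moreover have "2 * (m choose 2) = m * (m - 1)"
    proof -
      have "even (m * (m - 1))" by (cases m) auto
      then show ?thesis unfolding choose_two by simp
    qed
    ultimately have "2 * int (m choose 2) = int m * (int m - 1)" by (metis of_nat_mult of_nat_numeral)
    then have "of_int (2 * int (m choose 2)) = (of_int (int m * (int m - 1)) :: complex)" by simp
    then show ?thesis unfolding *(2) by (simp add: algebra_simps)
  qed
  \<comment> \<open>Centre 3 with the roots 1 and 2 gives 5 on the left. On the right the
    coefficients combine to \<open>2 * t - 5 * m + 9 * k\<close>; here \<open>m\<close> counts the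
    arcs, so \<open>2 * m = 3 * n\<close> and \<open>2 * k = n + 2\<close>.\<close>
  have "(1 - 3)\<^sup>2 + (2 - 3)\<^sup>2 \<le> (int m)\<^sup>2 - (int m * (int m - 1) - 2 * int t) - 2 * 3 * int m + int k * 3\<^sup>2"
    by (rule real_roots_sum_squares[OF coeffs(1,2) k2 _ c2 real])
      (use root[of 1] root[of 2] nz_flows_1 nz_flows_2 *(1) in auto)
  then have "5 \<le> 2 * int t - 5 * int m + 9 * int k" by (simp add: power2_eq_square algebra_simps)
  then show ?thesis using nm kn unfolding t_def n_def by linarith
qed

end

section \<open>Subdividing a triangle\<close>

text \<open>The differences of the coefficients sum to zero. A nonzero one at \<open>b\<close> would
  put \<open>b\<close> on the line through \<open>a\<close> and \<open>c\<close>, and then a nonzero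
  one at \<open>c\<close> would force \<open>c = a\<close>.\<close>

lemma barycentric_unique:
  fixes a b c :: complex
  assumes nc: "\<not> collinear {a, b, c}" and sum: "x + y + z = x' + y' + z'"
    and eq: "x *\<^sub>R a + y *\<^sub>R b + z *\<^sub>R c = x' *\<^sub>R a + y' *\<^sub>R b + z' *\<^sub>R c"
  shows "x = x' \<and> y = y' \<and> z = z'"
proof -
  define u v w where "u = x - x'" and "v = y - y'" and "w = z - z'"
  have s: "u + v + w = 0" using sum unfolding u_def v_def w_def by simp
  have e: "u *\<^sub>R a + v *\<^sub>R b + w *\<^sub>R c = 0"
    using eq unfolding u_def v_def w_def by (simp add: algebra_simps)
  have v0: "v = 0"
  proof (rule ccontr)
    assume v: "v \<noteq> 0"
    have "v *\<^sub>R b = v *\<^sub>R ((- u / v) *\<^sub>R a + (1 - - u / v) *\<^sub>R c)"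
    proof -
      have "v *\<^sub>R ((- u / v) *\<^sub>R a + (1 - - u / v) *\<^sub>R c) = - u *\<^sub>R a + (v + u) *\<^sub>R c"
      proof -
        have "v * (- u / v) = - u" "v * (1 - - u / v) = v + u" using v by (simp_all add: distrib_left)
        then show ?thesis unfolding scaleR_add_right scaleR_scaleR by (simp only:)
      qed
      also have "v + u = - w" using s by linarith
      also have "- u *\<^sub>R a + - w *\<^sub>R c = v *\<^sub>R b" using e by (simp add: algebra_simps add_eq_0_iff)
      finally show ?thesis by (rule sym)
    qed
    then have "b = (- u / v) *\<^sub>R a + (1 - - u / v) *\<^sub>R c" using v by simp
    then show False using nc unfolding collinear_3_expand by blast
  qed
  have "w *\<^sub>R (c - a) = 0"
  proof -
    have "u = - w" using s v0 by simp
    then show ?thesis using e v0 by (simp add: algebra_simps)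
  qed
  moreover have "c \<noteq> a" using nc unfolding collinear_3_expand by blast
  ultimately have "w = 0" by simp
  then show ?thesis using s v0 unfolding u_def v_def w_def by simp
qed

definition tri_interior :: "complex \<Rightarrow> complex \<Rightarrow> complex \<Rightarrow> complex set" where
  "tri_interior a b c = interior (convex hull {a, b, c})"

text \<open>Any interior point could be stacked; for the centroid, membership in the three
  subtriangles becomes a mere comparison of barycentric coordinates.\<close>

definition barycenter :: "complex \<Rightarrow> complex \<Rightarrow> complex \<Rightarrow> complex" where
  "barycenter a b c = (1/3) *\<^sub>R a + (1/3) *\<^sub>R b + (1/3) *\<^sub>R c"

lemma tri_interior_rotate: "tri_interior b c a = tri_interior a b c"
  by (simp add: tri_interior_def insert_commute)

lemma tri_interior_eq:
  assumes "\<not> collinear {a, b, c}"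
  shows "tri_interior a b c =
    {v. \<exists>x y z. 0 < x \<and> 0 < y \<and> 0 < z \<and> x + y + z = 1 \<and> x *\<^sub>R a + y *\<^sub>R b + z *\<^sub>R c = v}"
  unfolding tri_interior_def by (rule interior_convex_hull_3_minimal) (use assms in auto)

lemma mem_tri_interior:
  assumes "\<not> collinear {a, b, c}" "x + y + z = 1"
  shows "x *\<^sub>R a + y *\<^sub>R b + z *\<^sub>R c \<in> tri_interior a b c \<longleftrightarrow> 0 < x \<and> 0 < y \<and> 0 < z"
proof
  assume "x *\<^sub>R a + y *\<^sub>R b + z *\<^sub>R c \<in> tri_interior a b c"
  then obtain x' y' z' where *: "0 < x'" "0 < y'" "0 < z'" "x' + y' + z' = 1"
      "x' *\<^sub>R a + y' *\<^sub>R b + z' *\<^sub>R c = x *\<^sub>R a + y *\<^sub>R b + z *\<^sub>R c"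
    unfolding tri_interior_eq[OF assms(1)] by auto
  then have "x' = x \<and> y' = y \<and> z' = z" using assms by (intro barycentric_unique[OF assms(1)]) auto
  then show "0 < x \<and> 0 < y \<and> 0 < z" using * by auto
next
  assume "0 < x \<and> 0 < y \<and> 0 < z"
  then show "x *\<^sub>R a + y *\<^sub>R b + z *\<^sub>R c \<in> tri_interior a b c"
    unfolding tri_interior_eq[OF assms(1)] using assms(2) by blast
qed

context
  fixes a b c p :: complex
  assumes nc: "\<not> collinear {a, b, c}"
  defines "p \<equiv> barycenter a b c"
begin

lemma barycenter_combo:
  "s *\<^sub>R p + y *\<^sub>R b + z *\<^sub>R c = (s/3) *\<^sub>R a + (y + s/3) *\<^sub>R b + (z + s/3) *\<^sub>R c"
  unfolding p_def barycenter_def by (simp add: scaleR_add_right scaleR_add_left)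

lemma not_collinear_barycenter: "\<not> collinear {p, b, c}"
proof
  assume "collinear {p, b, c}"
  then consider "p = c" | u where "b = u *\<^sub>R p + (1 - u) *\<^sub>R c"
    unfolding collinear_3_expand by blast
  then show False
  proof cases
    case 1
    then have "(1/3) *\<^sub>R a + (1/3) *\<^sub>R b + (1/3) *\<^sub>R c = 0 *\<^sub>R a + 0 *\<^sub>R b + 1 *\<^sub>R c"
      unfolding p_def barycenter_def by simp
    from barycentric_unique[OF nc _ this] show False by simp
  next
    case 2
    have "0 *\<^sub>R a + 1 *\<^sub>R b + 0 *\<^sub>R c = (u/3) *\<^sub>R a + (0 + u/3) *\<^sub>R b + (1 - u + u/3) *\<^sub>R c"
      using 2 unfolding barycenter_combo[of u 0 "1 - u", symmetric] by simp
    from barycentric_unique[OF nc _ this] show False by auto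
  qed
qed

lemma mem_subtriangle:
  assumes "x + y + z = 1"
  shows "x *\<^sub>R a + y *\<^sub>R b + z *\<^sub>R c \<in> tri_interior p b c \<longleftrightarrow> 0 < x \<and> x < y \<and> x < z"
proof -
  have "x *\<^sub>R a + y *\<^sub>R b + z *\<^sub>R c = (3 * x) *\<^sub>R p + (y - x) *\<^sub>R b + (z - x) *\<^sub>R c"
    unfolding barycenter_combo by simp
  then show ?thesis
    using mem_tri_interior[OF not_collinear_barycenter, of "3 * x" "y - x" "z - x"] assms by auto
qed

lemma mem_spoke:
  assumes "x + y + z = 1"
  shows "x *\<^sub>R a + y *\<^sub>R b + z *\<^sub>R c \<in> closed_segment p a \<longleftrightarrow> 0 \<le> y \<and> y = z \<and> y \<le> x"
proof
  assume "x *\<^sub>R a + y *\<^sub>R b + z *\<^sub>R c \<in> closed_segment p a"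
  then obtain u where u: "0 \<le> u" "u \<le> 1" "x *\<^sub>R a + y *\<^sub>R b + z *\<^sub>R c = (1 - u) *\<^sub>R p + u *\<^sub>R a"
    unfolding closed_segment_def by auto
  have "(1 - u) *\<^sub>R p + u *\<^sub>R a = (u + (1 - u)/3) *\<^sub>R a + ((1 - u)/3) *\<^sub>R b + ((1 - u)/3) *\<^sub>R c"
    unfolding p_def barycenter_def by (simp add: scaleR_add_right scaleR_add_left)
  then have "x *\<^sub>R a + y *\<^sub>R b + z *\<^sub>R c =
      (u + (1 - u)/3) *\<^sub>R a + ((1 - u)/3) *\<^sub>R b + ((1 - u)/3) *\<^sub>R c" using u(3) by simp
  from barycentric_unique[OF nc _ this] show "0 \<le> y \<and> y = z \<and> y \<le> x"
    using u(1,2) assms by (simp add: field_simps)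
next
  assume h: "0 \<le> y \<and> y = z \<and> y \<le> x"
  have "(1 - (x - y)) *\<^sub>R p + (x - y) *\<^sub>R a =
      (x - y + (1 - (x - y))/3) *\<^sub>R a + ((1 - (x - y))/3) *\<^sub>R b + ((1 - (x - y))/3) *\<^sub>R c"
    unfolding p_def barycenter_def by (simp add: scaleR_add_right scaleR_add_left)
  moreover have "(1 - (x - y))/3 = y" "x - y + (1 - (x - y))/3 = x" using assms h by simp_all
  ultimately have "x *\<^sub>R a + y *\<^sub>R b + z *\<^sub>R c = (1 - (x - y)) *\<^sub>R p + (x - y) *\<^sub>R a"
    using h by (simp only:)
  then show "x *\<^sub>R a + y *\<^sub>R b + z *\<^sub>R c \<in> closed_segment p a"
    unfolding closed_segment_def using h assms by (intro CollectI exI[of _ "x - y"]) auto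
qed

lemma barycenter_mem: "p \<in> tri_interior a b c"
  unfolding p_def barycenter_def using mem_tri_interior[OF nc, of "1/3" "1/3" "1/3"] by simp

end

text \<open>In barycentric coordinates an interior point belongs to the subtriangle opposite to the
  corner whose coordinate is strictly smallest, and a tie for the smallest puts it on a spoke. Every
  claim thus becomes linear arithmetic on the simplex \<open>W\<close>, on which the coordinate map
  \<open>f\<close> is injective. The spokes lose their outer ends in the first identity because
  corners are not interior.\<close>

lemma triangle_subdivision:
  fixes a b c :: complex
  assumes nc: "\<not> collinear {a, b, c}"
  defines "p \<equiv> barycenter a b c"
  shows "tri_interior a b c =
      tri_interior p b c \<union> tri_interior p c a \<union> tri_interior p a b \<union>
      (closed_segment p a - {a}) \<union> (closed_segment p b - {b}) \<union> (closed_segment p c - {c})"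
    and "tri_interior p b c \<inter> tri_interior p c a = {}"
    and "tri_interior p b c \<inter> tri_interior p a b = {}"
    and "tri_interior p c a \<inter> tri_interior p a b = {}"
    and "(tri_interior p b c \<union> tri_interior p c a \<union> tri_interior p a b) \<inter>
      (closed_segment p a \<union> closed_segment p b \<union> closed_segment p c) = {}"
    and "closed_segment p a \<inter> closed_segment p b = {p}"
    and "closed_segment p a \<inter> closed_segment p c = {p}"
    and "closed_segment p b \<inter> closed_segment p c = {p}"
proof -
  have nc2: "\<not> collinear {b, c, a}" "\<not> collinear {c, a, b}" using nc by (simp_all add: insert_commute)
  have p2: "barycenter b c a = p" "barycenter c a b = p"
    unfolding p_def barycenter_def by (simp_all add: add_ac)
  define f where "f = (\<lambda>(x, y, z). x *\<^sub>R a + y *\<^sub>R b + z *\<^sub>R c)"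
  define W where "W = {(x, y, z :: real). 0 \<le> x \<and> 0 \<le> y \<and> 0 \<le> z \<and> x + y + z = 1}"
  have inj: "inj_on f W"
  proof (rule inj_onI)
    fix v w assume "v \<in> W" "w \<in> W" "f v = f w"
    moreover obtain x y z where v: "v = (x, y, z)" by (cases v)
    moreover obtain x' y' z' where w: "w = (x', y', z')" by (cases w)
    ultimately show "v = w"
      using barycentric_unique[OF nc, of x y z x' y' z'] unfolding f_def W_def by simp
  qed
  have hull: "convex hull {a, b, c} = f ` W"
  proof
    show "convex hull {a, b, c} \<subseteq> f ` W"
    proof
      fix v assume "v \<in> convex hull {a, b, c}"
      then obtain x y z where "0 \<le> x" "0 \<le> y" "0 \<le> z" "x + y + z = 1" "v = f (x, y, z)"
        unfolding convex_hull_3 f_def by auto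
      then show "v \<in> f ` W" unfolding W_def by blast
    qed
    show "f ` W \<subseteq> convex hull {a, b, c}" unfolding convex_hull_3 f_def W_def by auto
  qed
  have pT: "p \<in> convex hull {a, b, c}"
    using barycenter_mem[OF nc] interior_subset unfolding p_def tri_interior_def by blast
  have mono: "convex hull S \<subseteq> f ` W" if "S \<subseteq> convex hull {a, b, c}" for S
  proof -
    have "convex hull S \<subseteq> convex hull {a, b, c}"
      by (rule hull_minimal) (use that in auto)
    then show ?thesis by (simp only: hull)
  qed
  have abc: "a \<in> convex hull {a, b, c}" "b \<in> convex hull {a, b, c}" "c \<in> convex hull {a, b, c}"
    by (auto intro: hull_inc)
  have m: "f (x, y, z) \<in> tri_interior p b c \<longleftrightarrow> 0 < x \<and> x < y \<and> x < z"
    "f (x, y, z) \<in> tri_interior p c a \<longleftrightarrow> 0 < y \<and> y < z \<and> y < x"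
    "f (x, y, z) \<in> tri_interior p a b \<longleftrightarrow> 0 < z \<and> z < x \<and> z < y"
    "f (x, y, z) \<in> closed_segment p a \<longleftrightarrow> 0 \<le> y \<and> y = z \<and> y \<le> x"
    "f (x, y, z) \<in> closed_segment p b \<longleftrightarrow> 0 \<le> z \<and> z = x \<and> z \<le> y"
    "f (x, y, z) \<in> closed_segment p c \<longleftrightarrow> 0 \<le> x \<and> x = y \<and> x \<le> z"
    if "(x, y, z) \<in> W" for x y z
    using mem_subtriangle[OF nc, of x y z] mem_subtriangle[OF nc2(1), of y z x]
      mem_subtriangle[OF nc2(2), of z x y] mem_spoke[OF nc, of x y z] mem_spoke[OF nc2(1), of y z x]
      mem_spoke[OF nc2(2), of z x y] that
    unfolding f_def W_def p2 p_def[symmetric] by (simp_all add: add_ac)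
  have s: "tri_interior p b c \<subseteq> f ` W" "tri_interior p c a \<subseteq> f ` W" "tri_interior p a b \<subseteq> f ` W"
    "closed_segment p a \<subseteq> f ` W" "closed_segment p b \<subseteq> f ` W" "closed_segment p c \<subseteq> f ` W"
    unfolding tri_interior_def segment_convex_hull
    using pT abc by (auto intro!: mono order_trans[OF interior_subset] simp del: image_subset_iff)
  have corner: "a = f (1, 0, 0)" "b = f (0, 1, 0)" "c = f (0, 0, 1)" "p = f (1/3, 1/3, 1/3)"
    unfolding f_def p_def barycenter_def by simp_all
  have cW: "(1, 0, 0) \<in> W" "(0, 1, 0) \<in> W" "(0, 0, 1) \<in> W" "(1/3, 1/3, 1/3) \<in> W"
    unfolding W_def by simp_all
  have feq: "f w = f w' \<longleftrightarrow> w = w'" if "w \<in> W" "w' \<in> W" for w w'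
    using inj_on_eq_iff[OF inj that] .
  have eqI: "X = Y" if "X \<subseteq> f ` W" "Y \<subseteq> f ` W" "\<And>w. w \<in> W \<Longrightarrow> f w \<in> X \<longleftrightarrow> f w \<in> Y" for X Y
    using that by blast
  have TW: "tri_interior a b c \<subseteq> f ` W" unfolding hull[symmetric] tri_interior_def by (rule interior_subset)
  have mT: "f (x, y, z) \<in> tri_interior a b c \<longleftrightarrow> 0 < x \<and> 0 < y \<and> 0 < z" if "(x, y, z) \<in> W" for x y z
    using mem_tri_interior[OF nc, of x y z] that unfolding f_def W_def by simp
  have ma: "f w \<in> {a} \<longleftrightarrow> w = (1, 0, 0)" "f w \<in> {b} \<longleftrightarrow> w = (0, 1, 0)" "f w \<in> {c} \<longleftrightarrow> w = (0, 0, 1)"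
    "f w \<in> {p} \<longleftrightarrow> w = (1/3, 1/3, 1/3)" if "w \<in> W" for w
    using feq[OF that] cW unfolding corner by auto
  show "tri_interior a b c =
      tri_interior p b c \<union> tri_interior p c a \<union> tri_interior p a b \<union>
      (closed_segment p a - {a}) \<union> (closed_segment p b - {b}) \<union> (closed_segment p c - {c})"
  proof (rule eqI)
    fix w assume w: "w \<in> W"
    obtain x y z where xyz: "w = (x, y, z)" by (cases w)
    note w' = w[unfolded xyz]
    have "x + y + z = 1" "0 \<le> x" "0 \<le> y" "0 \<le> z" using w' unfolding W_def by auto
    then show "f w \<in> tri_interior a b c \<longleftrightarrow> f w \<in> tri_interior p b c \<union> tri_interior p c a \<union> tri_interior p a b \<union>
      (closed_segment p a - {a}) \<union> (closed_segment p b - {b}) \<union> (closed_segment p c - {c})"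
      unfolding Un_iff Diff_iff ma[OF w] unfolding xyz m[OF w'] mT[OF w'] prod.inject by argo
  qed (use TW s in auto)
  show "tri_interior p b c \<inter> tri_interior p c a = {}" "tri_interior p b c \<inter> tri_interior p a b = {}"
    "tri_interior p c a \<inter> tri_interior p a b = {}"
    "(tri_interior p b c \<union> tri_interior p c a \<union> tri_interior p a b) \<inter>
      (closed_segment p a \<union> closed_segment p b \<union> closed_segment p c) = {}"
    by (rule eqI; use s m in force)+
  have q: "f w \<in> closed_segment p a \<inter> closed_segment p b \<longleftrightarrow> f w \<in> {p}"
    "f w \<in> closed_segment p a \<inter> closed_segment p c \<longleftrightarrow> f w \<in> {p}"
    "f w \<in> closed_segment p b \<inter> closed_segment p c \<longleftrightarrow> f w \<in> {p}" if w: "w \<in> W" for w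
  proof -
    obtain x y z where xyz: "w = (x, y, z)" by (cases w)
    note w' = w[unfolded xyz]
    have "x + y + z = 1" using w' unfolding W_def by auto
    then show "f w \<in> closed_segment p a \<inter> closed_segment p b \<longleftrightarrow> f w \<in> {p}"
      "f w \<in> closed_segment p a \<inter> closed_segment p c \<longleftrightarrow> f w \<in> {p}"
      "f w \<in> closed_segment p b \<inter> closed_segment p c \<longleftrightarrow> f w \<in> {p}"
      unfolding Int_iff ma[OF w] unfolding xyz m[OF w'] prod.inject by argo+
  qed
  have pW: "{p} \<subseteq> f ` W" using pT hull by auto
  show "closed_segment p a \<inter> closed_segment p b = {p}"
    by (rule eqI[OF _ pW q(1)]) (use s in auto)
  show "closed_segment p a \<inter> closed_segment p c = {p}"
    by (rule eqI[OF _ pW q(2)]) (use s in auto)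
  show "closed_segment p b \<inter> closed_segment p c = {p}"
    by (rule eqI[OF _ pW q(3)]) (use s in auto)
qed

lemma open_tri_interior: "open (tri_interior a b c)"
  and convex_tri_interior: "convex (tri_interior a b c)"
  unfolding tri_interior_def by (simp_all add: convex_interior)

lemma hull3_frontier:
  fixes a b c :: complex
  shows "frontier (convex hull {a, b, c}) = closed_segment b c \<union> closed_segment c a \<union> closed_segment a b"
  using frontier_of_triangle[of a b c] by (simp add: Un_ac closed_segment_commute)

lemma frontier_tri_interior:
  assumes "\<not> collinear {a, b, c}"
  shows "frontier (tri_interior a b c) = closed_segment b c \<union> closed_segment c a \<union> closed_segment a b"
proof -
  let ?H = "convex hull {a, b, c}"
  have "interior ?H \<noteq> {}" using barycenter_mem[OF assms] unfolding tri_interior_def by auto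
  then have "closure (interior ?H) = closure ?H" by (intro convex_closure_interior) auto
  then have "frontier (interior ?H) = frontier ?H" by (simp add: frontier_def)
  then show ?thesis unfolding tri_interior_def hull3_frontier .
qed

section \<open>Stacked triangulations\<close>

text \<open>In an induced cycle of length at least four, the two cycle neighbours of
  \<open>p\<close> are not adjacent, which contradicts \<open>clique\<close>; a cycle that misses
  \<open>p\<close> already existed before.\<close>

lemma chordal_insert:
  assumes ch: "chordal V adj" and p: "p \<notin> V"
    and old: "\<And>u v. u \<in> V \<Longrightarrow> v \<in> V \<Longrightarrow> adj' u v \<longleftrightarrow> adj u v"
    and sym: "\<And>u v. adj' u v \<Longrightarrow> adj' v u"
    and clique: "\<And>u v. adj' p u \<Longrightarrow> adj' p v \<Longrightarrow> u \<noteq> v \<Longrightarrow> adj' u v"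
  shows "chordal (insert p V) adj'"
  unfolding chordal_def
proof
  assume "\<exists>vs. induced_cycle (insert p V) adj' vs \<and> 3 < length vs"
  then obtain vs where ic: "induced_cycle (insert p V) adj' vs" and len: "3 < length vs" by auto
  let ?n = "length vs"
  have dist: "distinct vs" and sub: "set vs \<subseteq> insert p V"
    and adj': "\<And>i j. i < j \<Longrightarrow> j < ?n \<Longrightarrow> adj' (vs ! i) (vs ! j) \<longleftrightarrow> j = i + 1 \<or> i = 0 \<and> j = ?n - 1"
    using ic unfolding induced_cycle_def by auto
  show False
  proof (cases "p \<in> set vs")
    case False
    then have V: "set vs \<subseteq> V" using sub by auto
    then have "vs ! i \<in> V" if "i < ?n" for i using that nth_mem by blast
    then have "induced_cycle V adj vs"
      using dist V len adj' old unfolding induced_cycle_def by auto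
    then show False using ch len unfolding chordal_def by auto
  next
    case True
    then obtain k where k: "k < ?n" "vs ! k = p" by (auto simp: in_set_conv_nth)
    have nbrs: False if "i < j" "j < ?n" "adj' p (vs ! i)" "adj' p (vs ! j)" "j \<noteq> i + 1"
      "\<not> (i = 0 \<and> j = ?n - 1)" for i j
    proof -
      have "vs ! i \<noteq> vs ! j" using that dist by (simp add: nth_eq_iff_index_eq)
      then have "adj' (vs ! i) (vs ! j)" using clique that by blast
      then show False using adj' that by blast
    qed
    have n: "1 < ?n - 1" "?n - 1 < ?n" "?n - 1 \<noteq> 1 + 1" "0 < ?n - 2" "?n - 2 < ?n" "?n - 2 \<noteq> 0 + 1"
      "?n - 2 \<noteq> ?n - 1" "0 \<noteq> k \<Longrightarrow> k - 1 = 0 \<Longrightarrow> k + 1 \<noteq> ?n - 1" using len by linarith+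
    \<comment> \<open>The list closes up between its first and last positions, so the positions of
      the neighbours of \<open>p\<close> depend on whether \<open>p\<close> sits at an end.\<close>
    consider "k = 0" | "k = ?n - 1" | "0 < k" "k < ?n - 1" using k by linarith
    then show False
    proof cases
      case 1
      have "adj' (vs ! 0) (vs ! 1)" "adj' (vs ! 0) (vs ! (?n - 1))"
        using adj'[of 0 1] adj'[of 0 "?n - 1"] len by auto
      moreover have "vs ! 0 = p" using 1 k by simp
      ultimately show False using nbrs[of 1 "?n - 1"] n by auto
    next
      case 2
      have "adj' (vs ! 0) (vs ! (?n - 1))" "adj' (vs ! (?n - 2)) (vs ! (?n - 1))"
        using adj'[of 0 "?n - 1"] adj'[of "?n - 2" "?n - 1"] len by auto
      moreover have "vs ! (?n - 1) = p" using 2 k by simp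
      ultimately have "adj' p (vs ! 0)" "adj' p (vs ! (?n - 2))" using sym by metis+
      then show False using nbrs[of 0 "?n - 2"] n by auto
    next
      case 3
      have "adj' (vs ! (k - 1)) (vs ! k)" "adj' (vs ! k) (vs ! (k + 1))"
        using adj'[of "k - 1" k] adj'[of k "k + 1"] 3 by auto
      then have "adj' p (vs ! (k - 1))" "adj' p (vs ! (k + 1))" using sym k(2) by metis+
      moreover have "k - 1 < k + 1" "k + 1 < ?n" "k + 1 \<noteq> k - 1 + 1" "\<not> (k - 1 = 0 \<and> k + 1 = ?n - 1)"
        using 3 len by linarith+
      ultimately show False using nbrs by blast
    qed
  qed
qed

text \<open>Each label stands for the side opposite to its corner, so permuting the labels permutes
  the corners in the same way.\<close>

definition tri_face ::
  "complex set \<Rightarrow> ('e \<Rightarrow> complex set) \<Rightarrow> complex set \<Rightarrow> 'e \<Rightarrow> 'e \<Rightarrow> 'e \<Rightarrow> complex \<Rightarrow> complex \<Rightarrow> complex \<Rightarrow> bool" where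
  "tri_face V \<psi> F x y z a b c \<longleftrightarrow> {a, b, c} \<subseteq> V \<and> \<not> collinear {a, b, c} \<and>
     \<psi> x = closed_segment b c \<and> \<psi> y = closed_segment c a \<and> \<psi> z = closed_segment a b \<and>
     F = tri_interior a b c"

lemma tri_face_rotate: "tri_face V \<psi> F x y z a b c \<Longrightarrow> tri_face V \<psi> F y z x b c a"
  unfolding tri_face_def by (auto simp: insert_commute tri_interior_rotate)

lemma tri_face_swap: "tri_face V \<psi> F x y z a b c \<Longrightarrow> tri_face V \<psi> F y x z b a c"
  unfolding tri_face_def tri_interior_def by (auto simp: insert_commute closed_segment_commute)

text \<open>Needed because a face is given with an unordered set of labels; rotations and one swap
  generate all six orders.\<close>

lemma tri_face_relabel:
  assumes "tri_face V \<psi> F x y z a b c" "{x, y, z} = {x', y', z'}" "distinct [x', y', z']"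
  obtains a' b' c' where "tri_face V \<psi> F x' y' z' a' b' c'"
proof -
  have "(x', y', z') \<in> {(x, y, z), (y, z, x), (z, x, y), (y, x, z), (x, z, y), (z, y, x)}"
  proof -
    have "x' \<in> {x, y, z}" "y' \<in> {x, y, z}" "z' \<in> {x, y, z}" using assms(2) by blast+
    then show ?thesis using assms(3) by auto
  qed
  moreover note r = tri_face_rotate[OF assms(1)]
  moreover note r2 = tri_face_rotate[OF r]
  moreover note tri_face_swap[OF assms(1)] tri_face_swap[OF r] tri_face_swap[OF r2]
  ultimately show thesis using assms(1) that by auto
qed

text \<open>The invariant of the stacking. \<open>D F\<close> holds the labels of the edges around
  the face of \<open>F\<close>, and \<open>r\<close> is the outer face. With
  \<open>edge_cut G\<close> for \<open>D\<close> and a partition for \<open>P\<close>, this is a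
  drawing of the dual of the graph with all parts contracted. For \<open>r\<close>,
  \<open>tri_face\<close> describes the bounded side of the outer triangle; the face itself is the
  complement of the hull.\<close>

definition drawing :: "'f set \<Rightarrow> 'f \<Rightarrow> ('f \<Rightarrow> 'e set) \<Rightarrow> complex set \<Rightarrow>
    ('e \<Rightarrow> complex set) \<Rightarrow> ('f \<Rightarrow> complex set) \<Rightarrow> bool" where
  "drawing P r D V \<psi> \<phi> \<longleftrightarrow> finite V \<and> r \<notin> P \<and>
     (\<forall>x \<in> \<Union>(D ` insert r P). \<exists>a b. a \<noteq> b \<and> \<psi> x = closed_segment a b \<and> \<psi> x \<inter> V = {a, b}) \<and>
     (\<forall>x \<in> \<Union>(D ` insert r P). \<forall>y \<in> \<Union>(D ` insert r P). x \<noteq> y \<longrightarrow>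
        \<psi> x \<inter> V \<noteq> \<psi> y \<inter> V \<and> \<psi> x \<inter> \<psi> y \<subseteq> V) \<and>
     (\<forall>A \<in> P. \<exists>x y z a b c. D A = {x, y, z} \<and> tri_face V \<psi> (\<phi> A) x y z a b c) \<and>
     (\<exists>x y z a b c. D r = {x, y, z} \<and> tri_face V \<psi> (tri_interior a b c) x y z a b c \<and>
        \<phi> r = - (convex hull {a, b, c})) \<and>
     disjoint_family_on \<phi> (insert r P) \<and>
     \<Union>(\<phi> ` insert r P) = - (V \<union> \<Union>(\<psi> ` \<Union>(D ` insert r P))) \<and>
     chordal V (plane_adj V (\<psi> ` \<Union>(D ` insert r P)))"

text \<open>The starting point: the dual of two vertices joined by three parallel edges, so both
  faces carry the same labels.\<close>

lemma drawing_triangle: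
  assumes "R \<noteq> r" "distinct [x, y, z]" "D R = {x, y, z}" "D r = {x, y, z}"
  shows "\<exists>V \<psi> \<phi>. drawing {R} r D V \<psi> \<phi>"
proof -
  obtain a b c :: complex where abc: "a = 0" "b = 1" "c = \<i>" by blast
  have nc: "\<not> collinear {a, b, c}"
    unfolding abc collinear_3_expand by (auto simp: complex_eq_iff)
  have ne: "a \<noteq> b" "b \<noteq> c" "c \<noteq> a" unfolding abc by (auto simp: complex_eq_iff)
  define \<psi> where "\<psi> e = (if e = x then closed_segment b c else if e = y then closed_segment c a
    else closed_segment a b)" for e
  define \<phi> where "\<phi> F = (if F = R then tri_interior a b c else - (convex hull {a, b, c}))" for F
  have \<psi>: "\<psi> x = closed_segment b c" "\<psi> y = closed_segment c a" "\<psi> z = closed_segment a b"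
    using assms(2) unfolding \<psi>_def by auto
  have L: "\<Union>(D ` insert r {R}) = {x, y, z}" using assms by auto
  have segV: "closed_segment b c \<inter> {a, b, c} = {b, c}" "closed_segment c a \<inter> {a, b, c} = {c, a}"
    "closed_segment a b \<inter> {a, b, c} = {a, b}"
    using ne unfolding abc by (auto simp: closed_segment_def complex_eq_iff)
  have seg2: "closed_segment b c \<inter> closed_segment c a \<subseteq> {c}" "closed_segment b c \<inter> closed_segment a b \<subseteq> {b}"
    "closed_segment c a \<inter> closed_segment a b \<subseteq> {a}"
    unfolding abc by (auto simp: closed_segment_def complex_eq_iff)
  have F: "\<phi> R = tri_interior a b c" "\<phi> r = - (convex hull {a, b, c})"
    using assms(1) unfolding \<phi>_def by auto
  have "convex hull {a, b, c} = tri_interior a b c \<union> frontier (convex hull {a, b, c})"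
  proof -
    have "closed (convex hull {a, b, c})" by (simp add: compact_imp_closed compact_convex_hull)
    then have "closure (convex hull {a, b, c}) = convex hull {a, b, c}" by (rule closure_closed)
    then show ?thesis unfolding tri_interior_def frontier_def
      using interior_subset[of "convex hull {a, b, c}"] by auto
  qed
  moreover have "frontier (convex hull {a, b, c}) \<inter> tri_interior a b c = {}"
    unfolding tri_interior_def frontier_def by auto
  ultimately have union: "\<phi> r \<union> \<phi> R = - (closed_segment b c \<union> closed_segment c a \<union> closed_segment a b)"
    and disj: "\<phi> r \<inter> \<phi> R = {}"
    unfolding F hull3_frontier by blast+
  have ch: "chordal {a, b, c} adj" for adj
    unfolding chordal_def induced_cycle_def
  proof (intro notI, elim exE conjE)
    fix vs assume "distinct vs" "set vs \<subseteq> {a, b, c}" "3 < length vs"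
    moreover have "card {a, b, c} \<le> 3" by (simp add: card_insert_if)
    ultimately show False using card_mono[of "{a, b, c}" "set vs"] distinct_card[of vs] by simp
  qed
  have tri: "tri_face {a, b, c} \<psi> (tri_interior a b c) x y z a b c"
    using nc \<psi> unfolding tri_face_def by simp
  have "drawing {R} r D {a, b, c} \<psi> \<phi>"
    unfolding drawing_def L
  proof (intro conjI)
    show "\<forall>x'\<in>{x, y, z}. \<exists>a' b'. a' \<noteq> b' \<and> \<psi> x' = closed_segment a' b' \<and> \<psi> x' \<inter> {a, b, c} = {a', b'}"
      using \<psi> segV ne by auto
    show "\<forall>x'\<in>{x, y, z}. \<forall>y'\<in>{x, y, z}. x' \<noteq> y' \<longrightarrow>
        \<psi> x' \<inter> {a, b, c} \<noteq> \<psi> y' \<inter> {a, b, c} \<and> \<psi> x' \<inter> \<psi> y' \<subseteq> {a, b, c}"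
      using ne seg2 unfolding ball_simps \<psi> segV
      by (auto simp: doubleton_eq_iff)
    show "\<forall>A\<in>{R}. \<exists>x y z a' b' c'. D A = {x, y, z} \<and> tri_face {a, b, c} \<psi> (\<phi> A) x y z a' b' c'"
    proof -
      have "\<exists>x y z a' b' c'. D R = {x, y, z} \<and> tri_face {a, b, c} \<psi> (\<phi> R) x y z a' b' c'"
        unfolding F(1) using tri assms(3) by blast
      then show ?thesis by simp
    qed
    show "\<exists>x y z a' b' c'. D r = {x, y, z} \<and> tri_face {a, b, c} \<psi> (tri_interior a' b' c') x y z a' b' c' \<and>
        \<phi> r = - (convex hull {a', b', c'})"
      using tri assms(4) F by blast
    show "disjoint_family_on \<phi> (insert r {R})"
      using disj unfolding disjoint_family_on_def by auto
    have "{a, b, c} \<subseteq> closed_segment b c \<union> closed_segment c a \<union> closed_segment a b" by auto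
    then show "\<Union>(\<phi> ` insert r {R}) = - ({a, b, c} \<union> \<Union>(\<psi> ` {x, y, z}))"
      using union \<psi> by auto
  qed (use assms ch in auto)
  then show ?thesis by blast
qed

text \<open>The spoke \<open>x\<close> ends at the corner opposite to the side \<open>e1\<close>,
  and likewise for \<open>y\<close> and \<open>z\<close>. The subtriangle on \<open>e1\<close> is
  therefore bounded by the other two spokes \<open>y\<close> and \<open>z\<close>, which is the
  pattern of labels prescribed for \<open>A1\<close>.\<close>

lemma drawing_stack:
  assumes dr: "drawing P r D V \<psi> \<phi>" and A: "A \<in> P"
    and new: "A1 \<notin> insert r (P - {A})" "A2 \<notin> insert r (P - {A})" "A3 \<notin> insert r (P - {A})"
      "distinct [A1, A2, A3]"
    and dist: "distinct [e1, e2, e3, x, y, z]"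
    and D: "D A = {e1, e2, e3}" "D A1 = {e1, y, z}" "D A2 = {e2, z, x}" "D A3 = {e3, x, y}"
    and fresh: "{x, y, z} \<inter> \<Union>(D ` insert r P) = {}"
  shows "\<exists>V' \<psi>' \<phi>'. drawing (insert A1 (insert A2 (insert A3 (P - {A})))) r D V' \<psi>' \<phi>'"
proof -
  define L where "L = \<Union>(D ` insert r P)"
  define Q where "Q = P - {A}"
  have finV: "finite V" and rP: "r \<notin> P"
    and seg: "\<And>e. e \<in> L \<Longrightarrow> \<exists>a b. a \<noteq> b \<and> \<psi> e = closed_segment a b \<and> \<psi> e \<inter> V = {a, b}"
    and cross: "\<And>e e'. e \<in> L \<Longrightarrow> e' \<in> L \<Longrightarrow> e \<noteq> e' \<Longrightarrow> \<psi> e \<inter> V \<noteq> \<psi> e' \<inter> V \<and> \<psi> e \<inter> \<psi> e' \<subseteq> V"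
    and inner: "\<And>B. B \<in> P \<Longrightarrow> \<exists>x y z a b c. D B = {x, y, z} \<and> tri_face V \<psi> (\<phi> B) x y z a b c"
    and outer: "\<exists>x y z a b c. D r = {x, y, z} \<and> tri_face V \<psi> (tri_interior a b c) x y z a b c \<and>
        \<phi> r = - (convex hull {a, b, c})"
    and disj: "disjoint_family_on \<phi> (insert r P)"
    and union: "\<Union>(\<phi> ` insert r P) = - (V \<union> \<Union>(\<psi> ` L))"
    and ch: "chordal V (plane_adj V (\<psi> ` L))"
    using dr unfolding drawing_def L_def[symmetric] by auto
  obtain x0 y0 z0 a0 b0 c0 where tri0: "D A = {x0, y0, z0}" "tri_face V \<psi> (\<phi> A) x0 y0 z0 a0 b0 c0"
    using inner[OF A] by blast
  obtain a b c where tri: "tri_face V \<psi> (\<phi> A) e1 e2 e3 a b c"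
    by (rule tri_face_relabel[OF tri0(2), of e1 e2 e3]) (use D(1) tri0(1) dist in auto)
  define p where "p = barycenter a b c"
  define T where "T = tri_interior a b c"
  have abcV: "a \<in> V" "b \<in> V" "c \<in> V" and nc: "\<not> collinear {a, b, c}" and \<phi>A: "\<phi> A = T"
    and \<psi>e: "\<psi> e1 = closed_segment b c" "\<psi> e2 = closed_segment c a" "\<psi> e3 = closed_segment a b"
    using tri unfolding tri_face_def T_def by auto
  have ne: "a \<noteq> b" "b \<noteq> c" "c \<noteq> a" using nc by (auto simp: insert_commute)
  note sub = triangle_subdivision[OF nc, folded p_def T_def]
  have pT: "p \<in> T" unfolding p_def T_def by (rule barycenter_mem[OF nc])
  have eL: "e1 \<in> L" "e2 \<in> L" "e3 \<in> L" using A D(1) unfolding L_def by auto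
  \<comment> \<open>A face misses all vertices and edges. Everything new lies inside
    \<open>T\<close> except for the corners, so it cannot cross anything old.\<close>
  have TV: "T \<inter> V = {}" and T\<psi>: "\<And>e. e \<in> L \<Longrightarrow> T \<inter> \<psi> e = {}"
    using union A \<phi>A by blast+
  have pV: "p \<notin> V" using pT TV by auto
  have p\<psi>: "p \<notin> \<psi> e" if "e \<in> L" for e using pT T\<psi>[OF that] by auto
  define V' where "V' = insert p V"
  define \<psi>' where "\<psi>' = \<psi>(x := closed_segment p a, y := closed_segment p b, z := closed_segment p c)"
  define \<phi>' where "\<phi>' = \<phi>(A1 := tri_interior p b c, A2 := tri_interior p c a, A3 := tri_interior p a b)"
  have spokes: "closed_segment p a \<subseteq> insert a T" "closed_segment p b \<subseteq> insert b T" "closed_segment p c \<subseteq> insert c T"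
    using sub(1) by blast+
  have ends: "a \<in> closed_segment p a" "b \<in> closed_segment p b" "c \<in> closed_segment p c"
    "p \<in> closed_segment p a" "p \<in> closed_segment p b" "p \<in> closed_segment p c" by auto
  have pne: "p \<noteq> a" "p \<noteq> b" "p \<noteq> c" using pV abcV by auto
  have spokeV: "closed_segment p a \<inter> V' = {p, a}" "closed_segment p b \<inter> V' = {p, b}"
    "closed_segment p c \<inter> V' = {p, c}"
    using spokes ends TV abcV unfolding V'_def by blast+
  have new\<psi>: "\<psi>' x = closed_segment p a" "\<psi>' y = closed_segment p b" "\<psi>' z = closed_segment p c"
    using dist unfolding \<psi>'_def by auto
  have old\<psi>: "\<psi>' e = \<psi> e" if "e \<in> L" for e
    using that fresh unfolding \<psi>'_def L_def[symmetric] by auto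
  have oldV: "\<psi>' e \<inter> V' = \<psi> e \<inter> V" if "e \<in> L" for e
    using p\<psi>[OF that] old\<psi>[OF that] unfolding V'_def by auto
  have new\<phi>: "\<phi>' A1 = tri_interior p b c" "\<phi>' A2 = tri_interior p c a" "\<phi>' A3 = tri_interior p a b"
    using new(4) unfolding \<phi>'_def by auto
  have old\<phi>: "\<phi>' B = \<phi> B" if "B \<in> insert r Q" for B
    using that new unfolding \<phi>'_def Q_def by auto
  let ?P' = "insert A1 (insert A2 (insert A3 Q))"
  have L': "\<Union>(D ` insert r ?P') = {x, y, z} \<union> L"
  proof -
    have "\<Union>(D ` insert r ?P') = D A1 \<union> D A2 \<union> D A3 \<union> \<Union>(D ` insert r Q)" by auto
    also have "\<dots> = {x, y, z} \<union> (D A \<union> \<Union>(D ` insert r Q))" unfolding D by auto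
    also have "D A \<union> \<Union>(D ` insert r Q) = L" unfolding L_def Q_def using A by auto
    finally show ?thesis .
  qed
  have mono: "tri_face V' \<psi>' F e e' e'' u v w" if "tri_face V \<psi> F e e' e'' u v w" "{e, e', e''} \<subseteq> L"
    for F e e' e'' u v w
    using that old\<psi> unfolding tri_face_def V'_def by auto
  have nc2: "\<not> collinear {b, c, a}" "\<not> collinear {c, a, b}" using nc by (simp_all add: insert_commute)
  have p2: "barycenter b c a = p" "barycenter c a b = p"
    unfolding p_def barycenter_def by (simp_all add: add_ac)
  have ncp: "\<not> collinear {p, b, c}" "\<not> collinear {p, c, a}" "\<not> collinear {p, a, b}"
    using not_collinear_barycenter[OF nc] not_collinear_barycenter[OF nc2(1)]
      not_collinear_barycenter[OF nc2(2)] unfolding p2 p_def[symmetric] by auto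
  have tri1: "tri_face V' \<psi>' (\<phi>' A1) e1 z y p b c" and tri2: "tri_face V' \<psi>' (\<phi>' A2) e2 x z p c a"
    and tri3: "tri_face V' \<psi>' (\<phi>' A3) e3 y x p a b"
    using ncp abcV old\<psi>[OF eL(1)] old\<psi>[OF eL(2)] old\<psi>[OF eL(3)]
    unfolding tri_face_def new\<psi> new\<phi> \<psi>e V'_def by (auto simp: closed_segment_commute)
  have U0: "\<Union>(\<phi> ` insert r Q) \<inter> T = {}"
  proof -
    have "\<phi> B \<inter> \<phi> A = {}" if "B \<in> insert r Q" for B
      by (rule disjoint_family_onD[OF disj]) (use that A rP in \<open>auto simp: Q_def\<close>)
    then show ?thesis unfolding \<phi>A by auto
  qed
  have U1: "\<Union>(\<phi> ` insert r Q) \<union> T = - (V \<union> \<Union>(\<psi> ` L))"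
    using union A unfolding \<phi>A[symmetric] Q_def by auto
  have subT: "\<phi>' A1 \<subseteq> T" "\<phi>' A2 \<subseteq> T" "\<phi>' A3 \<subseteq> T" unfolding new\<phi> using sub(1) by blast+
  have old_Un: "\<Union>(\<phi>' ` insert r Q) = \<Union>(\<phi> ` insert r Q)" using old\<phi> by auto
  have "drawing ?P' r D V' \<psi>' \<phi>'"
    unfolding drawing_def L'
  proof (intro conjI)
    show "finite V'" using finV unfolding V'_def by simp
    show "r \<notin> ?P'" using rP new unfolding Q_def by auto
    show "\<forall>e\<in>{x, y, z} \<union> L. \<exists>a b. a \<noteq> b \<and> \<psi>' e = closed_segment a b \<and> \<psi>' e \<inter> V' = {a, b}"
    proof
      fix e assume "e \<in> {x, y, z} \<union> L"
      then consider "e = x" | "e = y" | "e = z" | "e \<in> L" by auto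
      then show "\<exists>a b. a \<noteq> b \<and> \<psi>' e = closed_segment a b \<and> \<psi>' e \<inter> V' = {a, b}"
      proof cases
        case 4 then show ?thesis using seg[OF 4] oldV[OF 4] old\<psi>[OF 4] by simp
      qed (use new\<psi> spokeV pne in auto)
    qed
    have on: "\<psi>' e \<inter> V' \<noteq> \<psi>' e' \<inter> V' \<and> \<psi>' e \<inter> \<psi>' e' \<subseteq> V'" if e: "e \<in> L" and e': "e' \<in> {x, y, z}" for e e'
    proof -
      have "p \<in> \<psi>' e' \<inter> V'" "\<psi>' e' \<subseteq> V \<union> T"
        using e' new\<psi> spokes abcV ends unfolding V'_def by auto
      then show ?thesis using p\<psi>[OF e] T\<psi>[OF e] old\<psi>[OF e] unfolding V'_def by blast
    qed
    have nn: "\<psi>' e \<inter> V' \<noteq> \<psi>' e' \<inter> V' \<and> \<psi>' e \<inter> \<psi>' e' \<subseteq> V'"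
      if "e \<in> {x, y, z}" "e' \<in> {x, y, z}" "e \<noteq> e'" for e e'
    proof -
      have "\<psi>' e \<inter> \<psi>' e' = {p}"
        using that new\<psi> sub(6-8) by (auto simp: Int_commute)
      moreover have "\<psi>' e \<inter> V' \<noteq> {p}" using that(1) new\<psi> spokeV pne by auto
      ultimately show ?thesis unfolding V'_def by blast
    qed
    show "\<forall>e\<in>{x, y, z} \<union> L. \<forall>e'\<in>{x, y, z} \<union> L. e \<noteq> e' \<longrightarrow>
        \<psi>' e \<inter> V' \<noteq> \<psi>' e' \<inter> V' \<and> \<psi>' e \<inter> \<psi>' e' \<subseteq> V'"
    proof (intro ballI impI)
      fix e e' assume e: "e \<in> {x, y, z} \<union> L" and e': "e' \<in> {x, y, z} \<union> L" and ee: "e \<noteq> e'"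
      consider "e \<in> L" "e' \<in> L" | "e \<in> L" "e' \<in> {x, y, z}" | "e' \<in> L" "e \<in> {x, y, z}"
        | "e \<in> {x, y, z}" "e' \<in> {x, y, z}" using e e' by blast
      then show "\<psi>' e \<inter> V' \<noteq> \<psi>' e' \<inter> V' \<and> \<psi>' e \<inter> \<psi>' e' \<subseteq> V'"
      proof cases
        case 1
        then show ?thesis using cross[OF 1 ee] old\<psi> oldV unfolding V'_def by auto
      next
        case 2 then show ?thesis by (rule on)
      next
        case 3 from on[OF this] show ?thesis by (metis Int_commute)
      next
        case 4 from nn[OF this ee] show ?thesis .
      qed
    qed
    show "\<forall>B\<in>?P'. \<exists>x y z a b c. D B = {x, y, z} \<and> tri_face V' \<psi>' (\<phi>' B) x y z a b c"
    proof
      fix B assume "B \<in> ?P'"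
      then consider "B = A1" | "B = A2" | "B = A3" | "B \<in> Q" by auto
      then show "\<exists>x y z a b c. D B = {x, y, z} \<and> tri_face V' \<psi>' (\<phi>' B) x y z a b c"
      proof cases
        case 1
        have "D A1 = {e1, z, y}" using D(2) by auto
        then show ?thesis using tri1 1 by blast
      next
        case 2
        have "D A2 = {e2, x, z}" using D(3) by auto
        then show ?thesis using tri2 2 by blast
      next
        case 3
        have "D A3 = {e3, y, x}" using D(4) by auto
        then show ?thesis using tri3 3 by blast
      next
        case 4
        then have "B \<in> P" "B \<in> insert r Q" unfolding Q_def by auto
        obtain e e' e'' u v w where *: "D B = {e, e', e''}" "tri_face V \<psi> (\<phi> B) e e' e'' u v w"
          using inner[OF \<open>B \<in> P\<close>] by blast
        have "{e, e', e''} \<subseteq> L" using * \<open>B \<in> P\<close> unfolding L_def by blast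
        then show ?thesis using mono[OF *(2)] *(1) old\<phi>[OF \<open>B \<in> insert r Q\<close>] by metis
      qed
    qed
    show "\<exists>x y z a b c. D r = {x, y, z} \<and> tri_face V' \<psi>' (tri_interior a b c) x y z a b c \<and>
        \<phi>' r = - (convex hull {a, b, c})"
    proof -
      obtain e e' e'' u v w where *: "D r = {e, e', e''}" "tri_face V \<psi> (tri_interior u v w) e e' e'' u v w"
        "\<phi> r = - (convex hull {u, v, w})"
        using outer by blast
      have "{e, e', e''} \<subseteq> L" using *(1) unfolding L_def by auto
      then show ?thesis using mono[OF *(2)] *(1,3) old\<phi>[of r] by (metis insertI1)
    qed
    have "disjoint_family_on \<phi> (insert r Q)"
      by (rule disjoint_family_on_mono[OF _ disj]) (auto simp: Q_def)
    then have d0: "disjoint_family_on \<phi>' (insert r Q)"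
      using old\<phi> unfolding disjoint_family_on_def by simp
    have h: "\<phi>' A1 \<inter> \<Union>(\<phi>' ` insert r Q) = {}" "\<phi>' A2 \<inter> \<Union>(\<phi>' ` insert r Q) = {}"
      "\<phi>' A3 \<inter> \<Union>(\<phi>' ` insert r Q) = {}" using U0 subT unfolding old_Un by blast+
    have hh: "\<phi>' A1 \<inter> \<phi>' A2 = {}" "\<phi>' A1 \<inter> \<phi>' A3 = {}" "\<phi>' A2 \<inter> \<phi>' A3 = {}"
      using sub(2-4) unfolding new\<phi> .
    have n: "A3 \<notin> insert r Q" "A2 \<notin> insert A3 (insert r Q)" "A1 \<notin> insert A2 (insert A3 (insert r Q))"
      using new unfolding Q_def by auto
    have d1: "disjoint_family_on \<phi>' (insert A3 (insert r Q))"
      unfolding disjoint_family_on_insert[OF n(1)] using d0 h(3) by blast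
    have d2: "disjoint_family_on \<phi>' (insert A2 (insert A3 (insert r Q)))"
      unfolding disjoint_family_on_insert[OF n(2)] using d1 h(2) hh(3) by auto
    have "disjoint_family_on \<phi>' (insert A1 (insert A2 (insert A3 (insert r Q))))"
      unfolding disjoint_family_on_insert[OF n(3)] using d2 h(1) hh(1,2) by auto
    then show "disjoint_family_on \<phi>' (insert r ?P')" by (simp add: insert_commute)
    have "\<Union>(\<phi>' ` insert r ?P') = \<phi>' A1 \<union> \<phi>' A2 \<union> \<phi>' A3 \<union> \<Union>(\<phi> ` insert r Q)"
      unfolding old_Un[symmetric] by auto
    also have "\<dots> = (T - (closed_segment p a \<union> closed_segment p b \<union> closed_segment p c)) \<union> \<Union>(\<phi> ` insert r Q)"
      using sub(1,5) unfolding new\<phi> by blast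
    also have "\<dots> = (T \<union> \<Union>(\<phi> ` insert r Q)) - (closed_segment p a \<union> closed_segment p b \<union> closed_segment p c)"
      using U0 U1 spokes abcV by blast
    also have "\<dots> = - (V \<union> \<Union>(\<psi> ` L)) - (closed_segment p a \<union> closed_segment p b \<union> closed_segment p c)"
      using U1 by blast
    also have "\<dots> = - (V' \<union> \<Union>(\<psi>' ` ({x, y, z} \<union> L)))"
      using ends old\<psi> unfolding V'_def by (auto simp: new\<psi>)
    finally show "\<Union>(\<phi>' ` insert r ?P') = - (V' \<union> \<Union>(\<psi>' ` ({x, y, z} \<union> L)))" .
    let ?adj = "plane_adj V' (\<psi>' ` ({x, y, z} \<union> L))"
    have adj_iff: "?adj u v \<longleftrightarrow> u \<noteq> v \<and> (\<exists>e\<in>{x, y, z} \<union> L. \<psi>' e \<inter> V' = {u, v})" for u v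
      unfolding plane_adj_def by auto
    have "chordal (insert p V) ?adj"
    proof (rule chordal_insert[OF ch pV])
      show "?adj u v \<longleftrightarrow> plane_adj V (\<psi> ` L) u v" if uv: "u \<in> V" "v \<in> V" for u v
      proof -
        have "\<psi>' e \<inter> V' \<noteq> {u, v}" if "e \<in> {x, y, z}" for e
          using that uv pV spokeV new\<psi> by auto
        then show ?thesis unfolding adj_iff unfolding plane_adj_def using oldV by auto
      qed
      show "?adj v u" if "?adj u v" for u v using that unfolding adj_iff by (auto simp: insert_commute)
      \<comment> \<open>An old edge misses \<open>p\<close>, so the neighbours of \<open>p\<close>
        are the three corners; the sides \<open>e1\<close>, \<open>e2\<close>, \<open>e3\<close>
        make them a clique.\<close>
      have nb: "u \<in> {a, b, c}" if u: "?adj p u" for u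
      proof -
        obtain e where e: "e \<in> {x, y, z} \<union> L" "\<psi>' e \<inter> V' = {p, u}" using u unfolding adj_iff by blast
        then have "e \<notin> L" using oldV[of e] pV by auto
        then show ?thesis using e spokeV new\<psi> by (auto simp: doubleton_eq_iff)
      qed
      have tr: "\<psi>' e1 \<inter> V' = {b, c}" "\<psi>' e2 \<inter> V' = {c, a}" "\<psi>' e3 \<inter> V' = {a, b}"
      proof -
        have *: "closed_segment u v \<inter> V = {u, v}" if "\<psi> e = closed_segment u v" "e \<in> L" for e u v
          using seg[OF that(2)] that(1) by (auto simp: closed_segment_eq doubleton_eq_iff)
        show "\<psi>' e1 \<inter> V' = {b, c}" "\<psi>' e2 \<inter> V' = {c, a}" "\<psi>' e3 \<inter> V' = {a, b}"
          using *[OF \<psi>e(1) eL(1)] *[OF \<psi>e(2) eL(2)] *[OF \<psi>e(3) eL(3)] oldV eL \<psi>e by auto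
      qed
      have adjI: "?adj u v \<and> ?adj v u" if "e \<in> L" "\<psi>' e \<inter> V' = {u, v}" "u \<noteq> v" for e u v
        using that unfolding adj_iff by (metis UnI2 insert_commute)
      show "?adj u v" if "?adj p u" "?adj p v" "u \<noteq> v" for u v
        using nb[OF that(1)] nb[OF that(2)] that(3) adjI[OF eL(1) tr(1) ne(2)] adjI[OF eL(2) tr(2) ne(3)]
          adjI[OF eL(3) tr(3) ne(1)] by blast
    qed
    then show "chordal V' ?adj" unfolding V'_def .
  qed
  then show ?thesis unfolding Q_def by blast
qed

text \<open>Disjoint nonempty open connected sets that fill an open set are its components, so the
  prescribed faces are all the faces, and no Jordan curve argument is involved.\<close>

theorem drawing_dual:
  assumes dr: "drawing P r D V \<psi> \<phi>"
  defines "L \<equiv> \<Union>(D ` insert r P)"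
  defines "E \<equiv> \<psi> ` L"
  shows "plane_triangulation V E" "chordal V (plane_adj V E)"
    "bij_betw \<phi> (insert r P) (plane_faces V E)" "bij_betw \<psi> L E"
    "\<And>e F. e \<in> L \<Longrightarrow> F \<in> insert r P \<Longrightarrow> \<psi> e \<subseteq> frontier (\<phi> F) \<longleftrightarrow> e \<in> D F"
proof -
  have finV: "finite V" and rP: "r \<notin> P"
    and seg: "\<And>e. e \<in> L \<Longrightarrow> \<exists>a b. a \<noteq> b \<and> \<psi> e = closed_segment a b \<and> \<psi> e \<inter> V = {a, b}"
    and cross: "\<And>e e'. e \<in> L \<Longrightarrow> e' \<in> L \<Longrightarrow> e \<noteq> e' \<Longrightarrow> \<psi> e \<inter> V \<noteq> \<psi> e' \<inter> V \<and> \<psi> e \<inter> \<psi> e' \<subseteq> V"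
    and inner: "\<And>B. B \<in> P \<Longrightarrow> \<exists>x y z a b c. D B = {x, y, z} \<and> tri_face V \<psi> (\<phi> B) x y z a b c"
    and outer: "\<exists>x y z a b c. D r = {x, y, z} \<and> tri_face V \<psi> (tri_interior a b c) x y z a b c \<and>
        \<phi> r = - (convex hull {a, b, c})"
    and disj: "disjoint_family_on \<phi> (insert r P)"
    and union: "\<Union>(\<phi> ` insert r P) = - (V \<union> \<Union>E)"
    and ch: "chordal V (plane_adj V E)"
    using dr unfolding drawing_def L_def[symmetric] E_def[symmetric] by auto
  show "chordal V (plane_adj V E)" by (rule ch)
  have face: "\<exists>x y z a b c. D F = {x, y, z} \<and> \<not> collinear {a, b, c} \<and> \<psi> x = closed_segment b c \<and>
      \<psi> y = closed_segment c a \<and> \<psi> z = closed_segment a b \<and> {a, b, c} \<subseteq> V \<and>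
      frontier (\<phi> F) = \<psi> x \<union> \<psi> y \<union> \<psi> z \<and> open (\<phi> F) \<and> Topological_Spaces.connected (\<phi> F) \<and> \<phi> F \<noteq> {}"
    if F: "F \<in> insert r P" for F
  proof (cases "F = r")
    case True
    obtain x y z a b c where *: "D r = {x, y, z}" "tri_face V \<psi> (tri_interior a b c) x y z a b c"
      "\<phi> r = - (convex hull {a, b, c})" using outer by blast
    have "bounded (convex hull {a, b, c})" "closed (convex hull {a, b, c})"
      by (simp_all add: bounded_convex_hull compact_imp_closed compact_convex_hull)
    moreover from this have "Topological_Spaces.connected (\<phi> r)" unfolding *(3)
      by (intro connected_complement_bounded_convex) auto
    moreover have "\<phi> r \<noteq> {}"
      using \<open>bounded (convex hull {a, b, c})\<close> not_bounded_UNIV[where 'a=complex] unfolding *(3)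
      by (metis Compl_empty_eq double_complement)
    ultimately show ?thesis
      using * True unfolding tri_face_def
      by (intro exI[of _ x] exI[of _ y] exI[of _ z] exI[of _ a] exI[of _ b] exI[of _ c])
        (simp add: frontier_complement hull3_frontier open_Compl)
  next
    case False
    then obtain x y z a b c where *: "D F = {x, y, z}" "tri_face V \<psi> (\<phi> F) x y z a b c"
      using inner F by blast
    then have nc: "\<not> collinear {a, b, c}" and \<phi>F: "\<phi> F = tri_interior a b c" unfolding tri_face_def by auto
    have "\<phi> F \<noteq> {}" unfolding \<phi>F using barycenter_mem[OF nc] by auto
    moreover have "frontier (\<phi> F) = closed_segment b c \<union> closed_segment c a \<union> closed_segment a b"
      unfolding \<phi>F by (rule frontier_tri_interior[OF nc])
    moreover have "open (\<phi> F)" "Topological_Spaces.connected (\<phi> F)"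
      unfolding \<phi>F by (simp_all add: open_tri_interior convex_tri_interior convex_connected)
    ultimately show ?thesis
      using * unfolding tri_face_def
      by (intro exI[of _ x] exI[of _ y] exI[of _ z] exI[of _ a] exI[of _ b] exI[of _ c]) simp
  qed
  have inj\<phi>: "inj_on \<phi> (insert r P)"
  proof (rule inj_onI, rule ccontr)
    fix F F' assume "F \<in> insert r P" "F' \<in> insert r P" "\<phi> F = \<phi> F'" "F \<noteq> F'"
    then have "\<phi> F = {}" using disjoint_family_onD[OF disj, of F F'] by auto
    then show False using face[OF \<open>F \<in> insert r P\<close>] by blast
  qed
  have faces: "plane_faces V E = \<phi> ` insert r P"
    unfolding plane_faces_def
  proof (rule components_open_unique)
    show "pairwise disjnt (\<phi> ` insert r P)"
      by (rule pairwise_imageI) (use disjoint_family_onD[OF disj] in \<open>auto simp: disjnt_def\<close>)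
    show "\<Union>(\<phi> ` insert r P) = - (V \<union> \<Union>E)" by (rule union)
    show "open X \<and> Topological_Spaces.connected X \<and> X \<noteq> {}" if "X \<in> \<phi> ` insert r P" for X
      using that face by blast
  qed
  show "bij_betw \<phi> (insert r P) (plane_faces V E)"
    unfolding faces using inj\<phi> by (rule inj_on_imp_bij_betw)
  have inj\<psi>: "inj_on \<psi> L" by (rule inj_onI) (use cross in metis)
  then show "bij_betw \<psi> L E" unfolding E_def by (rule inj_on_imp_bij_betw)
  have DL: "D F \<subseteq> L" if "F \<in> insert r P" for F using that unfolding L_def by blast
  have pg: "plane_graph V E"
    unfolding plane_graph_def
  proof (intro conjI ballI impI)
    show "\<exists>g. arc g \<and> path_image g = e \<and> e \<inter> V = {pathstart g, pathfinish g}" if e: "e \<in> E" for e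
    proof -
      obtain x where x: "x \<in> L" "e = \<psi> x" using e unfolding E_def by auto
      obtain a b where "a \<noteq> b" "\<psi> x = closed_segment a b" "\<psi> x \<inter> V = {a, b}" using seg[OF x(1)] by blast
      then show ?thesis unfolding x(2) by (intro exI[of _ "linepath a b"]) (simp add: arc_linepath)
    qed
    show "e \<inter> V \<noteq> e' \<inter> V" "e \<inter> e' \<subseteq> V" if "e \<in> E" "e' \<in> E" "e \<noteq> e'" for e e'
      using that cross unfolding E_def by blast+
  qed (rule finV)
  show "plane_triangulation V E"
    unfolding plane_triangulation_def faces
  proof (intro conjI ballI)
    fix X assume "X \<in> \<phi> ` insert r P"
    then obtain F where F: "F \<in> insert r P" "X = \<phi> F" by auto
    obtain x y z a b c where *: "D F = {x, y, z}" "\<not> collinear {a, b, c}" "\<psi> x = closed_segment b c"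
      "\<psi> y = closed_segment c a" "\<psi> z = closed_segment a b" "{a, b, c} \<subseteq> V"
      "frontier (\<phi> F) = \<psi> x \<union> \<psi> y \<union> \<psi> z" using face[OF F(1)] by (elim exE conjE) (rule that; assumption)
    have xyz: "x \<in> L" "y \<in> L" "z \<in> L" using DL[OF F(1)] *(1) by auto
    have tr: "closed_segment u v \<inter> V = {u, v}" if "\<psi> e = closed_segment u v" "e \<in> L" for e u v
      using seg[OF that(2)] that(1) by (auto simp: closed_segment_eq doubleton_eq_iff)
    have "distinct [a, b, c]" using *(2) by (auto simp: insert_commute)
    moreover have "{\<psi> z, \<psi> x, \<psi> y} \<subseteq> E" using xyz unfolding E_def by auto
    moreover have "\<psi> z \<inter> V = {a, b}" "\<psi> x \<inter> V = {b, c}" "\<psi> y \<inter> V = {c, a}"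
      using tr[OF *(3) xyz(1)] tr[OF *(4) xyz(2)] tr[OF *(5) xyz(3)] *(3-5) by auto
    moreover have "frontier X = \<psi> z \<union> \<psi> x \<union> \<psi> y" using *(7) F(2) by auto
    ultimately show "\<exists>a b c e1 e2 e3. distinct [a, b, c] \<and> {e1, e2, e3} \<subseteq> E \<and> e1 \<inter> V = {a, b} \<and>
        e2 \<inter> V = {b, c} \<and> e3 \<inter> V = {c, a} \<and> frontier X = e1 \<union> e2 \<union> e3" by blast
  qed (rule pg)
  show "\<psi> e \<subseteq> frontier (\<phi> F) \<longleftrightarrow> e \<in> D F" if e: "e \<in> L" and F: "F \<in> insert r P" for e F
  proof -
    obtain x y z where *: "D F = {x, y, z}" "frontier (\<phi> F) = \<psi> x \<union> \<psi> y \<union> \<psi> z"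
      using face[OF F] by (elim exE conjE) (rule that; assumption)
    show ?thesis
    proof
      assume sub: "\<psi> e \<subseteq> frontier (\<phi> F)"
      show "e \<in> D F"
      proof (rule ccontr)
        assume "e \<notin> D F"
        then have "\<psi> e \<inter> \<psi> f \<subseteq> V" if "f \<in> D F" for f
          using cross[of e f] e that DL[OF F] by blast
        \<comment> \<open>An edge other than the three sides meets them only in vertices; lying on
          the frontier, it would be a finite segment.\<close>
        then have "\<psi> e \<subseteq> V" using sub * by blast
        then have "finite (\<psi> e)" using finV finite_subset by blast
        moreover obtain a b where "a \<noteq> b" "\<psi> e = closed_segment a b" using seg[OF e] by blast
        ultimately show False by (simp add: finite_closed_segment)
      qed
    qed (use * in auto)
  qed
qed

section \<open>Drawing the dual\<close>

context edge_connected_cubic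
begin

text \<open>The two bounds meet here: every member of \<open>tri_sets\<close> lies in the complement
  of \<open>r\<close>, so the lower bound from the roots is exactly the laminarity bound for that
  set.\<close>

lemma tight_root_compl:
  assumes "flow_roots G \<subseteq> \<real>"
  shows "tight (verts G - {r})"
proof -
  have "card (edge_cut G (verts G - {r})) = 3"
    using edge_cut_Compl[of "{r}"] card_edge_cut_singleton(1)[OF root] by simp
  then have R: "verts G - {r} \<in> tri_sets" unfolding tri_sets_def by auto
  have "{B \<in> tri_sets. B \<subseteq> verts G - {r}} = tri_sets" unfolding tri_sets_def by auto
  moreover have "card (verts G) = card (verts G - {r}) + 1" using card_Suc_Diff1[OF finite_verts root] by simp
  ultimately show ?thesis
    using tri_sets_card_le[OF R] card_tri_sets_ge[OF assms] R unfolding tight_def by simp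
qed

lemma drawing_refine:
  assumes dr: "drawing P {r} (edge_cut G) V \<psi> \<phi>" and disj: "disjoint P" and cover: "\<Union>P = verts G - {r}"
    and tight_P: "\<forall>A \<in> P. tight A" and A: "A \<in> P" "card A \<noteq> 1"
  shows "\<exists>P' V' \<psi>' \<phi>'. drawing P' {r} (edge_cut G) V' \<psi>' \<phi>' \<and> disjoint P' \<and> \<Union>P' = verts G - {r} \<and>
    (\<forall>A \<in> P'. tight A) \<and> card P < card P'"
proof -
  note tight = bspec[OF tight_P]
  obtain S where S: "card S = 3" "disjoint S" "\<Union>S = A" "\<And>B. B \<in> S \<Longrightarrow> tight B"
    using tight_split[OF tight[OF A(1)] A(2)] by blast
  obtain A1 A2 A3 where A123: "S = {A1, A2, A3}" "A1 \<noteq> A2" "A2 \<noteq> A3" "A1 \<noteq> A3"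
    using S(1) by (auto simp: card_3_iff)
  have dj: "A1 \<inter> A2 = {}" "A1 \<inter> A3 = {}" "A2 \<inter> A3 = {}"
    using S(2) A123 unfolding disjoint_def by auto
  have tri: "A1 \<in> tri_sets" "A2 \<in> tri_sets" "A3 \<in> tri_sets" "A \<in> tri_sets"
    using S(4) A123(1) tight A unfolding tight_def by auto
  have Aeq: "A1 \<union> A2 \<union> A3 = A" using S(3) A123(1) by auto
  obtain a b c x y z where e: "distinct [a, b, c, x, y, z]" "edge_cut G A = {a, b, c}"
    "edge_cut G A1 = {a, y, z}" "edge_cut G A2 = {b, z, x}" "edge_cut G A3 = {c, x, y}"
    using tri_sets_split_edges[OF tri(1-3) dj] tri(4) unfolding Aeq by metis
  have sub: "A1 \<subseteq> A" "A2 \<subseteq> A" "A3 \<subseteq> A" using Aeq by auto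
  have other: "B \<inter> A = {}" if "B \<in> insert {r} (P - {A})" for B
    using that disj A(1) cover unfolding disjoint_def by blast
  have ne: "A1 \<noteq> {}" "A2 \<noteq> {}" "A3 \<noteq> {}" using tri tri_setsD(5) by auto
  have new: "A1 \<notin> insert {r} (P - {A})" "A2 \<notin> insert {r} (P - {A})" "A3 \<notin> insert {r} (P - {A})"
    using other[of A1] other[of A2] other[of A3] ne sub by blast+
  \<comment> \<open>The edges between the three parts have both ends in \<open>A\<close>: each meets
    a part of \<open>A\<close> but is not in the cut of \<open>A\<close>. They are therefore in no
    cut of a set disjoint from \<open>A\<close>.\<close>
  have fresh: "{x, y, z} \<inter> \<Union>(edge_cut G ` insert {r} P) = {}"
  proof -
    have "f \<notin> edge_cut G B" if f: "f \<in> {x, y, z}" and B: "B \<in> insert {r} P" for f B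
    proof (cases "B = A")
      case True
      then show ?thesis using f e(1,2) by auto
    next
      case False
      have "f \<notin> edge_cut G A" "f \<in> edge_cut G A1 \<union> edge_cut G A2 \<union> edge_cut G A3" using f e by auto
      then have "tail G f \<in> A" "head G f \<in> A" using sub unfolding edge_cut_def by blast+
      moreover have "B \<inter> A = {}" using other B False by blast
      ultimately show ?thesis unfolding edge_cut_def by auto
    qed
    then show ?thesis by blast
  qed
  define P' where "P' = insert A1 (insert A2 (insert A3 (P - {A})))"
  have dist: "distinct [A1, A2, A3]" using A123 by auto
  obtain V' \<psi>' \<phi>' where dr': "drawing P' {r} (edge_cut G) V' \<psi>' \<phi>'"
    using drawing_stack[OF dr A(1) new dist e fresh] unfolding P'_def by blast
  have "disjoint P'"
  proof (rule disjointI)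
    fix B C assume BC: "B \<in> P'" "C \<in> P'" "B \<noteq> C"
    have S': "P' = S \<union> (P - {A})" unfolding P'_def A123 by auto
    have SP: "B \<inter> C = {}" if "B \<in> S" "C \<in> P - {A}" for B C using that other[of C] S(3) by blast
    consider "B \<in> S" "C \<in> S" | "B \<in> S" "C \<in> P - {A}" | "C \<in> S" "B \<in> P - {A}" | "B \<in> P" "C \<in> P"
      using BC(1,2) unfolding S' by blast
    then show "B \<inter> C = {}"
    proof cases
      case 1 then show ?thesis using disjointD[OF S(2)] BC(3) by simp
    next
      case 2 then show ?thesis by (rule SP)
    next
      case 3 from SP[OF this] show ?thesis by (simp add: Int_commute)
    next
      case 4 then show ?thesis using disjointD[OF disj] BC(3) by simp
    qed
  qed
  moreover have "\<Union>P' = verts G - {r}"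
  proof -
    have "\<Union>P' = A \<union> \<Union>(P - {A})" unfolding P'_def Aeq[symmetric] by auto
    also have "\<dots> = \<Union>P" using A(1) by auto
    finally show ?thesis unfolding cover .
  qed
  moreover have "\<forall>B \<in> P'. tight B" using tight S(4) A123 unfolding P'_def by auto
  moreover have "card P < card P'"
  proof -
    have "finite P" using cover by (metis finite_Diff finite_UnionD finite_verts)
    then have "card P' = card (P - {A}) + 3" unfolding P'_def using new dist by auto
    then show ?thesis using \<open>finite P\<close> A(1) by (simp add: card_Diff_singleton)
  qed
  ultimately show ?thesis using dr' by blast
qed

text \<open>Refinement stops because the parts are nonempty and disjoint, so there are never more of
  them than vertices.\<close>

lemma drawing_singletons:
  assumes "drawing P {r} (edge_cut G) V \<psi> \<phi>" "disjoint P" "\<Union>P = verts G - {r}" "\<forall>A \<in> P. tight A"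
  shows "\<exists>V \<psi> \<phi>. drawing ((\<lambda>v. {v}) ` (verts G - {r})) {r} (edge_cut G) V \<psi> \<phi>"
  using assms
proof (induction "card (verts G) - card P" arbitrary: P V \<psi> \<phi> rule: less_induct)
  case less
  show ?case
  proof (cases "\<forall>A \<in> P. card A = 1")
    case True
    have "P = (\<lambda>v. {v}) ` (verts G - {r})"
    proof (intro equalityI subsetI)
      fix A assume A: "A \<in> P"
      then obtain v where v: "A = {v}" using True by (auto simp: card_1_singleton_iff)
      then have "v \<in> \<Union>P" using A by auto
      then show "A \<in> (\<lambda>v. {v}) ` (verts G - {r})" unfolding less.prems(3) v by (rule imageI)
    next
      fix A assume "A \<in> (\<lambda>v. {v}) ` (verts G - {r})"
      then obtain v where v: "A = {v}" "v \<in> \<Union>P" using less.prems(3) by auto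
      then obtain B where B: "B \<in> P" "v \<in> B" by auto
      then have "B = {v}" using True by (auto simp: card_1_singleton_iff)
      then show "A \<in> P" using B v by simp
    qed
    then show ?thesis using less.prems(1) by blast
  next
    case False
    then obtain A where A: "A \<in> P" "card A \<noteq> 1" by auto
    obtain P' V' \<psi>' \<phi>' where P': "drawing P' {r} (edge_cut G) V' \<psi>' \<phi>'" "disjoint P'"
      "\<Union>P' = verts G - {r}" "\<forall>A \<in> P'. tight A" "card P < card P'"
      using drawing_refine[OF less.prems A] by (elim exE conjE) (rule that; assumption)
    have fin: "finite B" "B \<noteq> {}" if "B \<in> P'" for B
      using tri_setsD(3,5) bspec[OF P'(4) that] unfolding tight_def by auto
    have "card P' = (\<Sum>B\<in>P'. 1)" by simp
    also have "\<dots> \<le> (\<Sum>B\<in>P'. card B)"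
      by (rule sum_mono) (use fin in \<open>simp add: Suc_le_eq card_gt_0_iff\<close>)
    also have "\<dots> = card (\<Union>P')" using card_Union_disjoint[OF P'(2)] fin by simp
    also have "\<dots> \<le> card (verts G)" unfolding P'(3) by (rule card_mono) auto
    finally have "card (verts G) - card P' < card (verts G) - card P" using P'(5) by linarith
    from less.hyps[OF this P'(1-4)] show ?thesis .
  qed
qed

text \<open>Once all parts are singletons, the labels around a face are the edges at a vertex. As
  there are no loops, an edge occurs at precisely its two ends, which is the incidence condition of
  the dual.\<close>

theorem chordal_triangulation_dual:
  assumes "flow_roots G \<subseteq> \<real>"
  shows "\<exists>V E. plane_triangulation V E \<and> chordal V (plane_adj V E) \<and> geometric_dual G V E"
proof -
  let ?R = "verts G - {r}"
  have tR: "tight ?R" by (rule tight_root_compl[OF assms])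
  have cut_eq: "edge_cut G ?R = edge_cut G {r}" by (rule edge_cut_Compl)
  obtain x y z where xyz: "edge_cut G {r} = {x, y, z}" "x \<noteq> y" "y \<noteq> z" "x \<noteq> z"
    using card_edge_cut_singleton(1)[OF root] by (auto simp: card_3_iff)
  \<comment> \<open>The inner face stands for all vertices other than \<open>r\<close>, contracted
    to one; its cut is the cut of \<open>r\<close>.\<close>
  obtain V0 \<psi>0 \<phi>0 where "drawing {?R} {r} (edge_cut G) V0 \<psi>0 \<phi>0"
    using drawing_triangle[of ?R "{r}" x y z "edge_cut G"] xyz cut_eq by auto
  from drawing_singletons[OF this] tR
  obtain V \<psi> \<phi> where dr: "drawing ((\<lambda>v. {v}) ` ?R) {r} (edge_cut G) V \<psi> \<phi>" by auto
  have faces: "insert {r} ((\<lambda>v. {v}) ` ?R) = (\<lambda>v. {v}) ` verts G" using root by auto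
  have cut_iff: "e \<in> edge_cut G {v} \<longleftrightarrow> v = tail G e \<or> v = head G e" if "e \<in> arcs G" for e v
    using that no_loop[OF that] by (auto simp: edge_cut_def)
  have L: "\<Union>(edge_cut G ` (\<lambda>v. {v}) ` verts G) = arcs G"
  proof
    show "\<Union>(edge_cut G ` (\<lambda>v. {v}) ` verts G) \<subseteq> arcs G" by (intro UN_least edge_cut_subset)
    show "arcs G \<subseteq> \<Union>(edge_cut G ` (\<lambda>v. {v}) ` verts G)"
    proof
      fix e assume e: "e \<in> arcs G"
      then have "e \<in> edge_cut G {tail G e}" "tail G e \<in> verts G" using cut_iff by auto
      then show "e \<in> \<Union>(edge_cut G ` (\<lambda>v. {v}) ` verts G)" by blast
    qed
  qed
  define E where "E = \<psi> ` arcs G"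
  note dual = drawing_dual[OF dr, unfolded faces L, folded E_def]
  have "bij_betw (\<lambda>v. \<phi> {v}) (verts G) (plane_faces V E)"
    using bij_betw_trans[of "\<lambda>v. {v}" "verts G" "(\<lambda>v. {v}) ` verts G" \<phi>] dual(3)
    by (auto simp: comp_def bij_betw_def inj_on_def)
  moreover have "{\<phi> {tail G e}, \<phi> {head G e}} = {F \<in> plane_faces V E. \<psi> e \<subseteq> frontier F}"
    if e: "e \<in> arcs G" for e
  proof -
    have "plane_faces V E = (\<lambda>v. \<phi> {v}) ` verts G" using dual(3) by (auto simp: bij_betw_def)
    then have "{F \<in> plane_faces V E. \<psi> e \<subseteq> frontier F} =
        (\<lambda>v. \<phi> {v}) ` {v \<in> verts G. \<psi> e \<subseteq> frontier (\<phi> {v})}" by auto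
    also have "{v \<in> verts G. \<psi> e \<subseteq> frontier (\<phi> {v})} = {v \<in> verts G. v = tail G e \<or> v = head G e}"
    proof (intro Collect_cong conj_cong refl)
      fix v assume "v \<in> verts G"
      then show "\<psi> e \<subseteq> frontier (\<phi> {v}) \<longleftrightarrow> v = tail G e \<or> v = head G e"
        using dual(5)[OF e, of "{v}"] cut_iff[OF e, of v] by simp
    qed
    also have "\<dots> = {tail G e, head G e}" using e by auto
    finally show ?thesis by simp
  qed
  ultimately have "geometric_dual G V E" unfolding geometric_dual_def using dual(4) by blast
  then show ?thesis using dual(1,2) by blast
qed

end

theorem theorem5p3:
  fixes G :: "('v, 'e) pre_digraph"
  assumes "fin_digraph G"
    and "k_connected 3 G"
    and "cubic G"
    and "flow_roots G \<subseteq> \<real>"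
  shows "\<exists>V E. plane_triangulation V E \<and> chordal V (plane_adj V E) \<and> geometric_dual G V E"
proof -
  have "card (verts G) > 3" using assms(2) unfolding k_connected_def by auto
  then obtain r where "r \<in> verts G" by fastforce
  then interpret edge_connected_cubic G r
    using assms fin_digraph.k_connected_3_edge_cut
    unfolding edge_connected_cubic_def edge_connected_cubic_axioms_def by blast
  show ?thesis by (rule chordal_triangulation_dual[OF assms(4)])
qed

end
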